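(* Let $\mathcal{Q}$ be the space of quadrilaterals modulo similarity, parameterized as described in the context. The set of all $\frac{\pi}{107}$-near square quadrilaterals in $\mathcal{Q}$ is contained in the union of finitely many orbit tiles. In particular, every $\frac{\pi}{107}$-near square quadrilateral has a periodic billiard path.
   Context: Parameterization: a quadrilateral is cut by a diagonal into two triangles. The four angles $(a_1,a_2,a_3,a_4)$ that this diagonal makes with the four sides (the angles of the two triangles at the endpoints of the diagonal) determine the quadrilateral up to similarity, so $\mathcal{Q}\subset\mathbb{R}^4$. For $\varepsilon>0$, a quadrilateral with parameters $(a_1,a_2,a_3,a_4)$ is called $\varepsilon$-near square if $|a_i-\pi/4|<\varepsilon$ for every $i$. A billiard path in a polygon is a straight-line trajectory inside the polygon that reflects off the sides with angle of incidence equal to angle of reflection. Trajectories hitting vertices are excluded. It is periodic if it repeats itself. The sides of a quadrilateral are labelled $0,1,2,3$. The orbit type of a periodic billiard path is the word recording the labels of the sides hit during one period. If this word has odd length, the orbit type is its square, so orbit types always have even length. For a word $W$, the orbit tile $O(W)\subset\mathcal{Q}$ is the set of quadrilaterals that have a periodic billiard path of orbit type $W$. *)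

theory Defs
  imports "HOL-Analysis.Analysis"
begin

text \<open>Parameter space.  A quadrilateral ABCD (vertices in cyclic order) is cut by the
diagonal AC into triangles ABC and ACD.  The parameters are
  a$1 = angle at A between AC and AB,  a$2 = angle at C between CA and CB,
  a$3 = angle at C between CA and CD,  a$4 = angle at A between AC and AD.
Normalising A = 0, C = 1 in the complex plane (similarity), B lies above and D below
the real axis.\<close>

definition quad_space :: "(real^4) set" where
  "quad_space = {a. (\<forall>i. 0 < a$i) \<and> a$1 + a$2 < pi \<and> a$3 + a$4 < pi}"

definition vertex :: "real^4 \<Rightarrow> nat \<Rightarrow> complex" where
  "vertex a k =
     (if k mod 4 = 0 then 0
      else if k mod 4 = 1 then complex_of_real (sin (a$2) / sin (a$1 + a$2)) * cis (a$1)
      else if k mod 4 = 2 then 1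
      else complex_of_real (sin (a$3) / sin (a$3 + a$4)) * cis (- a$4))"

definition open_side :: "real^4 \<Rightarrow> nat \<Rightarrow> complex set" where
  "open_side a k = open_segment (vertex a k) (vertex a (Suc k))"

definition quad_region :: "real^4 \<Rightarrow> complex set" where
  "quad_region a = convex hull {vertex a 0, vertex a 1, vertex a 2}
                 \<union> convex hull {vertex a 0, vertex a 2, vertex a 3}"

definition reflect_side :: "real^4 \<Rightarrow> nat \<Rightarrow> complex \<Rightarrow> complex" where
  "reflect_side a k v =
     (let n = \<i> * sgn (vertex a (Suc k) - vertex a k)
      in v - complex_of_real (2 * (v \<bullet> n)) * n)"

definition billiard_path :: "real^4 \<Rightarrow> (nat \<Rightarrow> complex) \<Rightarrow> (nat \<Rightarrow> nat) \<Rightarrow> bool" where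
  "billiard_path a p s \<longleftrightarrow>
     (\<forall>i. s i < 4 \<and> p i \<in> open_side a (s i)
        \<and> p i \<noteq> p (Suc i)
        \<and> open_segment (p i) (p (Suc i)) \<subseteq> interior (quad_region a)
        \<and> sgn (p (Suc (Suc i)) - p (Suc i))
            = reflect_side a (s (Suc i)) (sgn (p (Suc i) - p i)))"

definition is_period :: "(nat \<Rightarrow> complex) \<Rightarrow> nat \<Rightarrow> bool" where
  "is_period p m \<longleftrightarrow> 0 < m \<and> (\<forall>i. p (i + m) = p i)"

definition periodic_billiard_path :: "real^4 \<Rightarrow> (nat \<Rightarrow> complex) \<Rightarrow> (nat \<Rightarrow> nat) \<Rightarrow> bool" where
  "periodic_billiard_path a p s \<longleftrightarrow> billiard_path a p s \<and> (\<exists>m. is_period p m)"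

definition orbit_type :: "(nat \<Rightarrow> complex) \<Rightarrow> (nat \<Rightarrow> nat) \<Rightarrow> nat list" where
  "orbit_type p s =
     (let m = (LEAST m. is_period p m); w = map s [0..<m]
      in if even m then w else w @ w)"

definition orbit_tile :: "nat list \<Rightarrow> (real^4) set" where
  "orbit_tile W = {a \<in> quad_space. \<exists>p s. periodic_billiard_path a p s \<and> orbit_type p s = W}"

definition near_square :: "real \<Rightarrow> real^4 \<Rightarrow> bool" where
  "near_square \<epsilon> a \<longleftrightarrow> (\<forall>i. \<bar>a$i - pi/4\<bar> < \<epsilon>)"

end

(* Every near-square quadrilateral has a periodic path hitting at most 28 sides per period, so the
   finitely many words of length at most 56 suffice. Up to relabelling the vertices A, B, C, D there
   are the following cases.
   - No acute angle: a rectangle, with the path bouncing between two opposite sides.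
   - Two adjacent acute angles: the orthic triangle (Fagnano path) of three of the sides.
   - Two opposite acute angles A, C: a path of length 8 along the diagonal AC, which exists exactly
     because both angles are acute.
   - One acute angle pi/2 - a at A, the others being pi/2 + b, pi/2 + c, pi/2 + d with a = b + c + d.
     If C is right there is a path of length 8 along AC; if B is right there is one that meets DA
     perpendicularly twice. Otherwise assume b <= d by reflection, whence a > 2b. Then there is a
     path near AB that meets its first and last side perpendicularly, and its combinatorics depends on
     whether a < 3b, a = 3b or a > 3b: the inequalities that the unfolding has to satisfy factor by
     sum-to-product formulas into exactly these conditions. *)

theory Submission
  imports Defs
begin

section \<open>Closed paths from chains of lines\<close>

text \<open>Twice the signed area of the triangle \<open>P\<close>, \<open>Q\<close>,
  \<open>z\<close>, positive when \<open>z\<close> lies to the left of the directed line from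
  \<open>P\<close> to \<open>Q\<close>.\<close>

definition cross :: "complex \<Rightarrow> complex \<Rightarrow> complex \<Rightarrow> real" where
  "cross P Q z = Im (cnj (Q - P) * (z - P))"

definition sides :: "complex \<Rightarrow> complex \<Rightarrow> complex \<Rightarrow> complex \<Rightarrow> (complex \<times> complex) set" where
  "sides A B C D = {(A, B), (B, C), (C, D), (D, A)}"

definition inside_sides :: "(complex \<times> complex) set \<Rightarrow> complex set" where
  "inside_sides E = {z. \<forall>(P, Q) \<in> E. 0 < cross P Q z}"

text \<open>The first two inequalities are weak because adjacent sides share a vertex; the sum
  excludes a second side lying entirely on the line of the first.\<close>

definition convex_sides :: "(complex \<times> complex) set \<Rightarrow> bool" where
  "convex_sides E \<longleftrightarrow> (\<forall>(P, Q) \<in> E. \<forall>(R, S) \<in> E. (P, Q) \<noteq> (R, S) \<longrightarrow>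
     0 \<le> cross P Q R \<and> 0 \<le> cross P Q S \<and> 0 < cross P Q R + cross P Q S)"

text \<open>For a unit vector \<open>e\<close>, the map sending \<open>u\<close> to
  \<open>e\<^sup>2 * cnj u\<close> is the reflection in the direction \<open>e\<close>. The law is
  stated at \<open>p (Suc i)\<close>; periodicity brings in \<open>p 0\<close>.\<close>

definition has_closed_path :: "(complex \<times> complex) set \<Rightarrow> nat \<Rightarrow> bool" where
  "has_closed_path E N \<longleftrightarrow> (\<exists>p m. 0 < m \<and> m \<le> N \<and> (\<forall>i. p (i + m) = p i) \<and>
     (\<forall>i. p i \<noteq> p (Suc i) \<and> open_segment (p i) (p (Suc i)) \<subseteq> inside_sides E \<and>
       (\<exists>(P, Q) \<in> E. p (Suc i) \<in> open_segment P Q \<and>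
          sgn (p (Suc (Suc i)) - p (Suc i)) = (sgn (Q - P))\<^sup>2 * cnj (sgn (p (Suc i) - p i)))))"

text \<open>An oriented line is a pair of a unit direction and an offset; \<open>ht\<close> is the signed
  distance, positive to the left of the line.\<close>

definition ht :: "complex \<times> real \<Rightarrow> complex \<Rightarrow> real" where
  "ht x z = Im (cnj (fst x) * z) - snd x"

text \<open>On a counterclockwise polygon a line leaves through the side \<open>(P, Q)\<close> with \<open>P\<close> on its
  right and \<open>Q\<close> on its left.\<close>

definition bounce :: "(complex \<times> complex) set \<Rightarrow> complex \<times> real \<Rightarrow> complex \<times> real \<Rightarrow> bool" where
  "bounce E x y \<longleftrightarrow> cmod (fst x) = 1 \<and> (\<exists>(P, Q) \<in> E. ht x P < 0 \<and> 0 < ht x Q \<and>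
     fst y = (sgn (Q - P))\<^sup>2 * cnj (fst x) \<and> ht y P = - ht x P)"

section \<open>Heights, reflected lines and time reversal\<close>

lemma ht_uminus [simp]: "ht (- x) z = - ht x z"
  by (simp add: ht_def)

lemma ht_diff: "ht x Q - ht x P = Im (cnj (fst x) * (Q - P))"
  by (simp add: ht_def algebra_simps)

lemma cross_affine: "cross P Q ((1 - t) *\<^sub>R x + t *\<^sub>R y) = (1 - t) * cross P Q x + t * cross P Q y"
  by (simp add: cross_def algebra_simps)

lemma cross_self [simp]: "cross P Q P = 0" "cross P Q Q = 0"
  by (simp_all add: cross_def algebra_simps)

lemma ht_affine: "ht l ((1 - t) *\<^sub>R x + t *\<^sub>R y) = (1 - t) * ht l x + t * ht l y"
  by (simp add: ht_def algebra_simps)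

lemma sgn_square_cnj: "(sgn z)\<^sup>2 * cnj z = z" for z :: complex
proof (cases "z = 0")
  case False
  have "(sgn z)\<^sup>2 * cnj z = z * (z * cnj z) / (of_real (cmod z))\<^sup>2"
    by (simp add: sgn_eq power2_eq_square)
  also have "\<dots> = z"
    using False by (simp add: complex_norm_square [symmetric] flip: of_real_power)
  finally show ?thesis .
qed simp

text \<open>The reflection turns \<open>cnj (fst x) * (Q - P)\<close> into its conjugate, so the
  height difference along the side changes sign; a sign change at one end carries over to the
  other.\<close>

lemma ht_reflect:
  assumes "fst y = (sgn (Q - P))\<^sup>2 * cnj (fst x)" "ht y P = - ht x P"
  shows "ht y Q = - ht x Q"
proof -
  have "cnj (fst y) * (Q - P) = fst x * cnj ((sgn (Q - P))\<^sup>2 * cnj (Q - P))"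
    by (simp add: assms(1))
  also have "\<dots> = cnj (cnj (fst x) * (Q - P))"
    by (simp only: sgn_square_cnj) simp
  finally have "ht y Q - ht y P = - (ht x Q - ht x P)"
    unfolding ht_diff by (simp only: cnj.sel)
  then show ?thesis
    using assms(2) by simp
qed

text \<open>Time reversal: the reversed outgoing line has the same heights at \<open>P\<close> and
  \<open>Q\<close> as the incoming one, and a reflection is an involution.\<close>

lemma bounce_uminus:
  assumes "bounce E x y"
  shows "bounce E (- y) (- x)"
proof -
  from assms obtain P Q where PQ: "(P, Q) \<in> E" "ht x P < 0" "0 < ht x Q" "cmod (fst x) = 1"
    "fst y = (sgn (Q - P))\<^sup>2 * cnj (fst x)" "ht y P = - ht x P"
    unfolding bounce_def by auto
  define e where "e = sgn (Q - P)"
  have "P \<noteq> Q"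
    using PQ by auto
  then have n: "cmod e = 1"
    by (simp add: e_def norm_sgn)
  then have "e * cnj e = 1"
    by (simp add: complex_norm_square [symmetric])
  then have "e\<^sup>2 * (cnj e)\<^sup>2 = 1"
    by (simp flip: power_mult_distrib)
  then have "fst x = e\<^sup>2 * cnj (fst y)"
    using PQ by (simp add: e_def[symmetric] mult.assoc[symmetric])
  moreover have "ht y Q = - ht x Q"
    by (rule ht_reflect) (use PQ in auto)
  moreover have "cmod (fst y) = 1"
    using PQ n by (simp add: e_def [symmetric] norm_mult norm_power)
  ultimately show ?thesis
    unfolding bounce_def using PQ e_def by (auto intro!: bexI [of _ "(P, Q)"])
qed

lemma convex_combination_pos:
  fixes t x y :: real
  assumes "0 < t" "t < 1" "0 \<le> x" "0 \<le> y" "0 < x \<or> 0 < y"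
  shows "0 < (1 - t) * x + t * y"
  using assms by (auto intro: add_pos_nonneg add_nonneg_pos)

lemma convex_sidesD:
  assumes "convex_sides E" "(T, U) \<in> E" "(V, W) \<in> E" "(T, U) \<noteq> (V, W)"
  shows "0 \<le> cross T U V" "0 \<le> cross T U W" "0 < cross T U V + cross T U W"
proof -
  have "\<forall>(R, S) \<in> E. (T, U) \<noteq> (R, S) \<longrightarrow>
     0 \<le> cross T U R \<and> 0 \<le> cross T U S \<and> 0 < cross T U R + cross T U S"
    using bspec [OF assms(1) [unfolded convex_sides_def] assms(2)] by simp
  from bspec [OF this assms(3)] assms(4)
  show "0 \<le> cross T U V" "0 \<le> cross T U W" "0 < cross T U V + cross T U W"
    by simp_all
qed

text \<open>Each open side lies strictly to the left of all other sides, so on a chord every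
  half-plane inequality is weak at both ends and strict at one of them.\<close>

lemma convex_segment_inner:
  assumes E: "convex_sides E" and "(P, Q) \<in> E" "(R, S) \<in> E" "(P, Q) \<noteq> (R, S)"
    and x: "x \<in> open_segment P Q" and y: "y \<in> open_segment R S"
  shows "open_segment x y \<subseteq> inside_sides E" "0 < cross P Q y"
proof -
  have on: "0 < cross T U z" if "(T, U) \<in> E" "(V, W) \<in> E" "(T, U) \<noteq> (V, W)" "z \<in> open_segment V W"
    for T U V W z
  proof -
    obtain t where t: "0 < t" "t < 1" "z = (1 - t) *\<^sub>R V + t *\<^sub>R W"
      using \<open>z \<in> open_segment V W\<close> unfolding in_segment by blast
    have "0 \<le> cross T U V" "0 \<le> cross T U W" "0 < cross T U V + cross T U W"
      using convex_sidesD [OF E that(1-3)] by auto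
    then have "0 < (1 - t) * cross T U V + t * cross T U W"
      using t by (intro convex_combination_pos) auto
    then show ?thesis
      by (simp add: t cross_affine)
  qed
  have self: "cross T U z = 0" if "z \<in> open_segment T U" for T U z
  proof -
    obtain t where t: "z = (1 - t) *\<^sub>R T + t *\<^sub>R U"
      using \<open>z \<in> open_segment T U\<close> unfolding in_segment by blast
    show ?thesis
      unfolding t cross_affine by simp
  qed
  show "0 < cross P Q y"
    by (rule on) (use assms in auto)
  show "open_segment x y \<subseteq> inside_sides E"
  proof
    fix z
    assume "z \<in> open_segment x y"
    then obtain t where t: "0 < t" "t < 1" "z = (1 - t) *\<^sub>R x + t *\<^sub>R y"
      unfolding in_segment by blast
    have "0 < cross T U z" if TU: "(T, U) \<in> E" for T U
    proof -
      have "0 \<le> cross T U x \<and> 0 \<le> cross T U y \<and> (0 < cross T U x \<or> 0 < cross T U y)"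
      proof (cases "(T, U) = (P, Q)")
        case True
        then show ?thesis
          using self [of x T U] on [of T U R S y] assms by auto
      next
        case False
        then have "0 < cross T U x"
          using on [OF TU assms(2) _ x] by auto
        moreover have "0 \<le> cross T U y"
          using self [of y T U] on [OF TU assms(3) _ y] y by fastforce
        ultimately show ?thesis
          by simp
      qed
      then have "0 < (1 - t) * cross T U x + t * cross T U y"
        using t by (intro convex_combination_pos) auto
      then show ?thesis
        by (simp add: t cross_affine)
    qed
    then show "z \<in> inside_sides E"
      by (auto simp: inside_sides_def)
  qed
qed

text \<open>The bounce points are the crossings of the lines with their exit sides. By convexity
  only the exits have to be checked: the chord between two different sides is automatically
  inside.\<close>

lemma closed_path_of_lines:
  fixes l :: "nat \<Rightarrow> complex \<times> real"
  assumes E: "convex_sides E" and m: "0 < m" "m \<le> N"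
    and per: "\<And>i. l (i + m) = l i" and step: "\<And>i. bounce E (l i) (l (Suc i))"
  shows "has_closed_path E N"
proof -
  \<comment> \<open>The side is chosen as a function of the two lines, not of the index, so that the
    bounce points inherit the period of \<open>l\<close>.\<close>
  have "\<exists>s. \<forall>x y. bounce E x y \<longrightarrow> s x y \<in> E \<and> ht x (fst (s x y)) < 0 \<and> 0 < ht x (snd (s x y)) \<and>
      fst y = (sgn (snd (s x y) - fst (s x y)))\<^sup>2 * cnj (fst x) \<and> ht y (fst (s x y)) = - ht x (fst (s x y))"
  proof (intro choice allI)
    fix x y
    show "\<exists>r. bounce E x y \<longrightarrow> r \<in> E \<and> ht x (fst r) < 0 \<and> 0 < ht x (snd r) \<and>
      fst y = (sgn (snd r - fst r))\<^sup>2 * cnj (fst x) \<and> ht y (fst r) = - ht x (fst r)"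
      unfolding bounce_def split_def by blast
  qed
  then obtain s where s: "\<And>x y. bounce E x y \<Longrightarrow> s x y \<in> E \<and> ht x (fst (s x y)) < 0 \<and> 0 < ht x (snd (s x y)) \<and>
      fst y = (sgn (snd (s x y) - fst (s x y)))\<^sup>2 * cnj (fst x) \<and> ht y (fst (s x y)) = - ht x (fst (s x y))"
    by blast
  define P where "P i = fst (s (l i) (l (Suc i)))" for i
  define Q where "Q i = snd (s (l i) (l (Suc i)))" for i
  have PQ: "(P i, Q i) \<in> E" "ht (l i) (P i) < 0" "0 < ht (l i) (Q i)"
    "fst (l (Suc i)) = (sgn (Q i - P i))\<^sup>2 * cnj (fst (l i))" "ht (l (Suc i)) (P i) = - ht (l i) (P i)" for i
    using s [OF step [of i]] unfolding P_def Q_def by auto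
  have QQ: "ht (l (Suc i)) (Q i) = - ht (l i) (Q i)" for i
    using ht_reflect PQ by blast
  have n1: "cmod (fst (l i)) = 1" for i
    using step unfolding bounce_def by blast
  \<comment> \<open>The zero of the height of \<open>l i\<close>, which is affine along the
    side.\<close>
  define t where "t i = - ht (l i) (P i) / (ht (l i) (Q i) - ht (l i) (P i))" for i
  define p where "p i = (1 - t i) *\<^sub>R P i + t i *\<^sub>R Q i" for i
  have t: "0 < t i" "t i < 1" for i
    using PQ [of i] by (auto simp: t_def field_simps)
  have seg: "p i \<in> open_segment (P i) (Q i)" for i
    using t [of i] PQ [of i] unfolding in_segment p_def by auto
  have on: "ht (l i) (p i) = 0" for i
    using PQ [of i] unfolding p_def ht_affine t_def by (simp add: field_simps)
  have on': "ht (l (Suc i)) (p i) = 0" for i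
    using on [of i] unfolding p_def ht_affine PQ QQ by (simp add: algebra_simps)
  \<comment> \<open>\<open>l (Suc i)\<close> has \<open>P i\<close> on its left but
    \<open>P (Suc i)\<close> on its right, so consecutive sides differ.\<close>
  have ne: "(P i, Q i) \<noteq> (P (Suc i), Q (Suc i))" for i
    using PQ [of i] PQ [of "Suc i"] by auto
  have pm: "p (i + m) = p i" for i
    using per [of i] per [of "Suc i"] by (simp add: p_def t_def P_def Q_def)
  have cr: "open_segment (p i) (p (Suc i)) \<subseteq> inside_sides E" "0 < cross (P i) (Q i) (p (Suc i))" for i
    using convex_segment_inner [OF E PQ(1) PQ(1) ne seg seg] by auto
  have dir: "p i \<noteq> p (Suc i) \<and> sgn (p (Suc i) - p i) = fst (l (Suc i))" for i
  proof -
    define u where "u = fst (l (Suc i))"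
    define e where "e = Q i - P i"
    define w where "w = p (Suc i) - p i"
    have u: "cnj u * u = 1"
      using n1 [of "Suc i"] complex_norm_square [of u] by (simp add: u_def mult.commute)
    define r where "r = Re (cnj u * w)"
    have "Im (cnj u * w) = 0"
      using ht_diff [of "l (Suc i)" "p (Suc i)" "p i"] on on' by (simp add: u_def w_def)
    then have "cnj u * w = of_real r" 
      by (simp add: complex_eq_iff r_def)
    then have w: "w = of_real r * u"
      using u by (metis mult.assoc mult.commute mult_1)
    \<comment> \<open>The direction \<open>u\<close> points to the inner side of \<open>e\<close>,
      and the next point lies there too, hence it is reached by going forwards: \<open>r\<close> is
      positive.\<close>
    have "Im (cnj u * e) < 0"
      using ht_diff [of "l (Suc i)" "Q i" "P i"] PQ [of i] QQ [of i] by (simp add: u_def e_def)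
    then have ue: "0 < Im (cnj e * u)"
      by (simp add: algebra_simps)
    have "cross (P i) (Q i) (p (Suc i)) = Im (cnj e * w) + cross (P i) (Q i) (p i)"
      by (simp add: cross_def e_def w_def algebra_simps)
    moreover have "cross (P i) (Q i) (p i) = 0"
      unfolding p_def cross_affine by simp
    ultimately have "0 < Im (cnj e * w)"
      using cr(2) [of i] by simp
    also have "Im (cnj e * w) = r * Im (cnj e * u)"
      by (subst w) (simp add: algebra_simps)
    finally have r0: "0 < r"
      using ue by (simp add: zero_less_mult_iff)
    then have "sgn w = u"
      using n1 [of "Suc i"] unfolding w by (simp add: sgn_eq norm_mult u_def)
    moreover have "w \<noteq> 0"
      using r0 by (auto simp: r_def)
    ultimately show ?thesis
      by (auto simp: w_def u_def)
  qed
  show ?thesis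
    unfolding has_closed_path_def
  proof (intro exI [of _ p] exI [of _ m] conjI allI m pm)
    fix i
    show "p i \<noteq> p (Suc i)" "open_segment (p i) (p (Suc i)) \<subseteq> inside_sides E"
      using dir cr by auto
    show "\<exists>(P, Q) \<in> E. p (Suc i) \<in> open_segment P Q \<and>
        sgn (p (Suc (Suc i)) - p (Suc i)) = (sgn (Q - P))\<^sup>2 * cnj (sgn (p (Suc i) - p i))"
      using PQ [of "Suc i"] seg [of "Suc i"] dir
      by (auto intro!: bexI [of _ "(P (Suc i), Q (Suc i))"])
  qed
qed

section \<open>Cyclic and palindromic lists of lines\<close>

lemma successively_nth:
  "successively R xs \<Longrightarrow> Suc i < length xs \<Longrightarrow> R (xs ! i) (xs ! Suc i)"
  by (induction R xs arbitrary: i rule: successively.induct) (auto simp: less_Suc_eq_0_disj)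

lemma closed_path_of_list:
  assumes E: "convex_sides E" and xs: "xs \<noteq> []" "length xs \<le> N"
    and step: "successively (bounce E) xs" "bounce E (last xs) (hd xs)"
  shows "has_closed_path E N"
proof (rule closed_path_of_lines [OF E])
  let ?m = "length xs"
  define l where "l i = xs ! (i mod ?m)" for i
  show "0 < ?m" "?m \<le> N"
    using xs by auto
  show "l (i + ?m) = l i" for i
    by (simp add: l_def)
  show "bounce E (l i) (l (Suc i))" for i
  proof (cases "Suc (i mod ?m) < ?m")
    case True
    then have "Suc i mod ?m = Suc (i mod ?m)"
      by (simp add: mod_Suc)
    then show ?thesis
      using successively_nth [OF step(1) True] by (simp add: l_def)
  next
    case False
    then have "Suc (i mod ?m) = ?m"
      using xs(1) by (metis Suc_lessI length_greater_0_conv mod_less_divisor)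
    then have "Suc i mod ?m = 0" "i mod ?m = ?m - 1"
      by (auto simp: mod_Suc)
    then show ?thesis
      using step(2) xs(1) by (simp add: l_def last_conv_nth hd_conv_nth)
  qed
qed

text \<open>A path meeting its first and last side perpendicularly retraces itself, so half of it
  determines a closed path; \<open>bounce_uminus\<close> supplies the way back.\<close>

lemma closed_path_of_palindrome:
  assumes E: "convex_sides E" and xs: "xs \<noteq> []" "2 * length xs \<le> N"
    and step: "successively (bounce E) xs" "bounce E (- hd xs) (hd xs)" "bounce E (last xs) (- last xs)"
  shows "has_closed_path E N"
proof (rule closed_path_of_list [OF E])
  let ?ys = "xs @ rev (map uminus xs)"
  show "?ys \<noteq> []" "length ?ys \<le> N"
    using xs by auto
  have "successively (\<lambda>x y. bounce E (- y) (- x)) xs"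
    using step(1) by (rule successively_mono) (use bounce_uminus in blast)
  then show "successively (bounce E) ?ys"
    using step xs by (simp add: successively_append_iff successively_rev successively_map hd_rev last_map)
  show "bounce E (last ?ys) (hd ?ys)"
    using step xs by (simp add: last_rev hd_map)
qed

section \<open>From closed paths to orbit tiles\<close>

lemma reflect_eq_square_cnj:
  fixes v d :: complex
  assumes "d \<noteq> 0"
  shows "(let n = \<i> * sgn d in v - complex_of_real (2 * (v \<bullet> n)) * n) = (sgn d)\<^sup>2 * cnj v"
proof -
  obtain x y where e: "sgn d = Complex x y"
    by (cases "sgn d")
  have "cmod (sgn d) = 1"
    using assms by (simp add: norm_sgn)
  then have "x\<^sup>2 + y\<^sup>2 = 1"
    by (simp add: e cmod_def)
  then have x: "x * x = 1 - y * y"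
    by (simp add: power2_eq_square)
  have "Re v - 2 * (Im v * x - Re v * y) * (- y) = (x * x - y * y) * Re v + 2 * x * y * Im v"
    "Im v - 2 * (Im v * x - Re v * y) * x = 2 * x * y * Re v - (x * x - y * y) * Im v"
    unfolding x by (algebra | use x in algebra)+
  then show ?thesis
    by (simp add: e Let_def complex_eq_iff inner_complex_def power2_eq_square algebra_simps)
qed

text \<open>The barycentric coordinates of \<open>z\<close> are quotients of signed areas.\<close>

lemma in_triangle_hull:
  assumes "0 \<le> cross P Q z" "0 \<le> cross Q R z" "0 \<le> cross R P z" "0 < cross P Q R"
  shows "z \<in> convex hull {P, Q, R}"
proof -
  define k where "k = cross P Q R"
  have sum: "cross Q R z + cross R P z + cross P Q z = k"
    by (simp add: k_def cross_def algebra_simps)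
  have "k *\<^sub>R z = cross Q R z *\<^sub>R P + cross R P z *\<^sub>R Q + cross P Q z *\<^sub>R R"
    by (simp add: k_def cross_def complex_eq_iff algebra_simps)
  then have "z = (cross Q R z / k) *\<^sub>R P + (cross R P z / k) *\<^sub>R Q + (cross P Q z / k) *\<^sub>R R"
    using assms(4) by (simp add: k_def [symmetric] complex_eq_iff field_simps)
  moreover have "cross Q R z / k + cross R P z / k + cross P Q z / k = 1"
    using sum assms(4) by (simp add: k_def [symmetric] flip: add_divide_distrib)
  ultimately show ?thesis
    unfolding convex_hull_3 mem_Collect_eq using assms
    by (intro exI [where x = "cross Q R z / k"] exI [where x = "cross R P z / k"]
      exI [where x = "cross P Q z / k"] conjI) (simp_all add: k_def)
qed

lemma vertex_simps [simp]: "vertex a 0 = 0" "vertex a 2 = 1" "vertex a 4 = 0"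
  "vertex a (Suc 0) = complex_of_real (sin (a$2) / sin (a$1 + a$2)) * cis (a$1)"
  "vertex a 3 = complex_of_real (sin (a$3) / sin (a$3 + a$4)) * cis (- a$4)"
  by (simp_all add: vertex_def)

text \<open>Vertex 1 lies above the real axis and vertex 3 below, so the order 0, 3, 2, 1 is the
  counterclockwise one that \<open>bounce\<close> requires.\<close>

abbreviation quad_sides :: "real^4 \<Rightarrow> (complex \<times> complex) set" where
  "quad_sides a \<equiv> sides (vertex a 0) (vertex a 3) (vertex a 2) (vertex a 1)"

lemma open_inner_sides: "open (inside_sides (sides A B C D))"
proof -
  have "inside_sides (sides A B C D) = (\<Inter>(P, Q) \<in> sides A B C D. {z. 0 < cross P Q z})"
    by (auto simp: inside_sides_def)
  moreover have "open {z. 0 < cross P Q z}" for P Q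
    unfolding cross_def by (intro open_Collect_less continuous_intros)
  ultimately show ?thesis
    by (simp add: sides_def open_Int)
qed

text \<open>As \<open>inside_sides\<close> is open, inclusion in the region suffices. The diagonal
  lies on the real axis, so the sign of \<open>Im z\<close> decides which triangle contains
  \<open>z\<close>.\<close>

lemma inner_subset_interior_region:
  assumes "a \<in> quad_space"
  shows "inside_sides (quad_sides a) \<subseteq> interior (quad_region a)"
proof (rule interior_maximal [OF _ open_inner_sides], rule subsetI)
  fix z
  assume z: "z \<in> inside_sides (quad_sides a)"
  have a: "0 < a$1" "0 < a$2" "0 < a$3" "0 < a$4" "a$1 + a$2 < pi" "a$3 + a$4 < pi"
    using assms by (auto simp: quad_space_def)
  then have s: "0 < sin (a$1)" "0 < sin (a$2)" "0 < sin (a$3)" "0 < sin (a$4)"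
    "0 < sin (a$1 + a$2)" "0 < sin (a$3 + a$4)"
    by (auto intro!: sin_gt_zero)
  have im: "0 < Im (vertex a 1)" "Im (vertex a 3) < 0"
    using s by (auto simp: divide_neg_pos mult_pos_neg)
  have c: "0 < cross (vertex a 0) (vertex a 3) z" "0 < cross (vertex a 3) (vertex a 2) z"
      "0 < cross (vertex a 2) (vertex a 1) z" "0 < cross (vertex a 1) (vertex a 0) z"
    using z by (auto simp: inside_sides_def sides_def)
  have e: "cross (vertex a 0) (vertex a 2) w = Im w" "cross (vertex a 2) (vertex a 0) w = - Im w" for w
    by (simp_all add: cross_def)
  show "z \<in> quad_region a"
  proof (cases "0 \<le> Im z")
    case True
    then have "z \<in> convex hull {vertex a 0, vertex a 2, vertex a 1}"
      using c im by (intro in_triangle_hull) (auto simp only: e)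
    then show ?thesis
      by (simp add: quad_region_def insert_commute)
  next
    case False
    have "cross (vertex a 0) (vertex a 3) (vertex a 2) = - Im (vertex a 3)"
      by (simp add: cross_def)
    then have "z \<in> convex hull {vertex a 0, vertex a 3, vertex a 2}"
      using c im False by (intro in_triangle_hull) (auto simp only: e)
    then show ?thesis
      by (simp add: quad_region_def insert_commute)
  qed
qed

text \<open>The least period is at most \<open>N\<close>; the factor 2 accounts for the squaring of
  words of odd length.\<close>

lemma billiard_of_closed_path:
  assumes a: "a \<in> quad_space" and closed: "has_closed_path (quad_sides a) N"
  obtains p s where "periodic_billiard_path a p s" "set (orbit_type p s) \<subseteq> {..<4}"
    "length (orbit_type p s) \<le> 2 * N"
proof -
  obtain p m where m: "0 < m" "m \<le> N" and per: "\<And>i. p (i + m) = p i"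
    and seg: "\<And>i. p i \<noteq> p (Suc i)" "\<And>i. open_segment (p i) (p (Suc i)) \<subseteq> inside_sides (quad_sides a)"
    and refl: "\<And>i. \<exists>(P, Q) \<in> quad_sides a. p (Suc i) \<in> open_segment P Q \<and>
       sgn (p (Suc (Suc i)) - p (Suc i)) = (sgn (Q - P))\<^sup>2 * cnj (sgn (p (Suc i) - p i))"
    using closed unfolding has_closed_path_def by blast
  have "\<exists>k<4. p (Suc i) \<in> open_side a k \<and>
      sgn (p (Suc (Suc i)) - p (Suc i)) = reflect_side a k (sgn (p (Suc i) - p i))" for i
  proof -
    obtain P Q where PQ: "(P, Q) \<in> quad_sides a" "p (Suc i) \<in> open_segment P Q"
       "sgn (p (Suc (Suc i)) - p (Suc i)) = (sgn (Q - P))\<^sup>2 * cnj (sgn (p (Suc i) - p i))"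
      using refl [of i] by auto
    have "P \<noteq> Q"
      using PQ by auto
    consider "P = vertex a (Suc 3)" "Q = vertex a 3" | "P = vertex a (Suc 2)" "Q = vertex a 2"
      | "P = vertex a (Suc 1)" "Q = vertex a 1" | "P = vertex a (Suc 0)" "Q = vertex a 0"
      using PQ(1) by (auto simp: sides_def numeral_2_eq_2 [symmetric])
    then obtain k where k: "k < 4" "Q = vertex a k" "P = vertex a (Suc k)"
    proof cases
      case 1 show ?thesis by (rule that [of 3]) (use 1 in auto)
    next
      case 2 show ?thesis by (rule that [of 2]) (use 2 in auto)
    next
      case 3 show ?thesis by (rule that [of 1]) (use 3 in auto)
    next
      case 4 show ?thesis by (rule that [of 0]) (use 4 in auto)
    qed
    have "(sgn (P - Q))\<^sup>2 = (sgn (Q - P))\<^sup>2"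
      by (metis minus_diff_eq power2_minus sgn_minus)
    then have "reflect_side a k v = (sgn (Q - P))\<^sup>2 * cnj v" for v
      using reflect_eq_square_cnj [of "P - Q" v] \<open>P \<noteq> Q\<close> by (simp add: reflect_side_def k)
    moreover have "open_side a k = open_segment P Q"
      by (simp add: open_side_def k open_segment_commute)
    ultimately show ?thesis
      using PQ k(1) by auto
  qed
  then obtain t where t: "\<And>i. t i < 4" "\<And>i. p (Suc i) \<in> open_side a (t i)"
    "\<And>i. sgn (p (Suc (Suc i)) - p (Suc i)) = reflect_side a (t i) (sgn (p (Suc i) - p i))"
    by metis
  \<comment> \<open>\<open>t i\<close> is the side at \<open>p (Suc i)\<close>; moving on by
    \<open>m - 1\<close>, which is one step back modulo the period, gives the side at
    \<open>p i\<close>.\<close>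
  define s where "s i = t (i + (m - 1))" for i
  have ms: "Suc (i + (m - 1)) = i + m" for i
    using m by simp
  have "billiard_path a p s"
    unfolding billiard_path_def
  proof (intro allI conjI)
    fix i
    show "s i < 4"
      by (simp add: s_def t)
    show "p i \<in> open_side a (s i)"
      using t(2) [of "i + (m - 1)"] by (simp only: ms per s_def)
    show "p i \<noteq> p (Suc i)"
      by (rule seg)
    show "open_segment (p i) (p (Suc i)) \<subseteq> interior (quad_region a)"
      using seg(2) inner_subset_interior_region [OF a] by blast
    have "p (Suc (Suc (Suc i + (m - 1)))) = p (Suc (Suc i))" "p (Suc (Suc i + (m - 1))) = p (Suc i)"
      "p (Suc i + (m - 1)) = p i"
      using per [of "Suc (Suc i)"] per [of "Suc i"] per [of i] m(1) by (simp_all add: ms)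
    then show "sgn (p (Suc (Suc i)) - p (Suc i)) = reflect_side a (s (Suc i)) (sgn (p (Suc i) - p i))"
      using t(3) [of "Suc i + (m - 1)"] by (simp only: s_def)
  qed
  moreover have "is_period p m"
    using m per by (simp add: is_period_def)
  moreover have "(LEAST m. is_period p m) \<le> N"
    using Least_le [of "is_period p" m] calculation m by linarith
  ultimately show ?thesis
    by (intro that [of p s])
      (auto simp: periodic_billiard_path_def orbit_type_def Let_def s_def t)
qed

lemma finite_cover_of_closed_paths:
  assumes "\<And>a. a \<in> quad_space \<Longrightarrow> R a \<Longrightarrow> has_closed_path (quad_sides a) N"
  shows "\<exists>S. finite S \<and> {a \<in> quad_space. R a} \<subseteq> (\<Union>W \<in> S. orbit_tile W)"
proof (intro exI conjI)
  let ?S = "{W. set W \<subseteq> {..<4::nat} \<and> length W \<le> 2 * N}"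
  show "finite ?S"
    by (rule finite_lists_length_le) simp
  show "{a \<in> quad_space. R a} \<subseteq> (\<Union>W \<in> ?S. orbit_tile W)"
  proof
    fix a
    assume "a \<in> {a \<in> quad_space. R a}"
    then have a: "a \<in> quad_space" "has_closed_path (quad_sides a) N"
      using assms by auto
    then obtain p s where "periodic_billiard_path a p s" "set (orbit_type p s) \<subseteq> {..<4}"
      "length (orbit_type p s) \<le> 2 * N"
      by (rule billiard_of_closed_path)
    then show "a \<in> (\<Union>W \<in> ?S. orbit_tile W)"
      using a by (auto simp: orbit_tile_def)
  qed
qed

section \<open>Near-square quadrilaterals\<close>

text \<open>The interior angles at \<open>A, B, C, D\<close> are \<open>\<pi>/2 - a\<close>, \<open>\<pi>/2 + b\<close>, \<open>\<pi>/2 + c\<close>, \<open>\<pi>/2 + d\<close>.\<close>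

locale near_square_quad =
  fixes A B C D \<omega> :: complex and l0 l1 l2 l3 a b c d :: real
  assumes norm_\<omega>: "cmod \<omega> = 1"
    and AB: "B - A = \<omega> * l0" and BC: "C - B = \<omega> * \<i> * cis (- b) * l1"
    and CD: "D - C = - (\<omega> * cis (- b - c) * l2)" and DA: "A - D = - (\<omega> * \<i> * cis (- a) * l3)"
    and sum: "a = b + c + d"
    and small: "\<bar>a\<bar> \<le> 0.059" "\<bar>b\<bar> \<le> 0.059" "\<bar>c\<bar> \<le> 0.059" "\<bar>d\<bar> \<le> 0.059"
    and l0: "0.68 \<le> l0" "l0 \<le> 0.73" and l1: "0.68 \<le> l1" "l1 \<le> 0.73"
    and l2: "0.68 \<le> l2" "l2 \<le> 0.73" and l3: "0.68 \<le> l3" "l3 \<le> 0.73"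

lemma abs_sin_le: "\<bar>sin x\<bar> \<le> \<bar>x\<bar>" for x :: real
  using abs_sin_x_le_abs_x by blast

lemma cos_ge_quadratic: "1 - x\<^sup>2 / 2 \<le> cos x" for x :: real
proof -
  have "\<bar>sin (x / 2)\<bar>\<^sup>2 \<le> \<bar>x / 2\<bar>\<^sup>2"
    by (rule power_mono [OF abs_sin_le]) simp
  then show ?thesis
    using cos_double_sin [of "x / 2"] by (simp add: power_divide)
qed

lemma cos_ge_9_10:
  fixes x :: real
  assumes "\<bar>x\<bar> \<le> 0.4"
  shows "0.9 \<le> cos x"
proof -
  have "x\<^sup>2 \<le> 0.4\<^sup>2"
    using assms by (subst abs_le_square_iff [symmetric]) simp
  then show ?thesis
    using cos_ge_quadratic [of x] by (simp add: power2_eq_square)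
qed

context near_square_quad
begin

text \<open>Cyclic relabelling starting at \<open>B\<close>. The deviation is subtracted from the
  right angle at the first vertex only, whence the signs of \<open>b\<close> and \<open>a\<close>
  flip.\<close>

lemma shift: "near_square_quad B C D A (\<omega> * \<i> * cis (- b)) l1 l2 l3 l0 (- b) c d (- a)"
proof
  show "cmod (\<omega> * \<i> * cis (- b)) = 1"
    using norm_\<omega> by (simp add: norm_mult)
  show "C - B = \<omega> * \<i> * cis (- b) * complex_of_real l1"
    by (rule BC)
  have "cis (- b - c) = cis (- b) * cis (- c)"
    by (simp add: cis_mult)
  then show "D - C = \<omega> * \<i> * cis (- b) * \<i> * cis (- c) * complex_of_real l2"
    unfolding CD by (simp add: algebra_simps)
  have "cis (- b) * cis (- c - d) = cis (- a)"
    by (simp add: cis_mult sum algebra_simps)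
  then show "A - D = - (\<omega> * \<i> * cis (- b) * cis (- c - d) * complex_of_real l3)"
    unfolding DA by (simp add: mult.assoc)
  have "cis (- b) * cis b = 1"
    by (simp add: cis_mult)
  then show "B - A = - (\<omega> * \<i> * cis (- b) * \<i> * cis (- (- b)) * complex_of_real l0)"
    unfolding AB by (simp add: algebra_simps)
  show "- b = c + d + - a"
    using sum by simp
qed (use small l0 l1 l2 l3 in auto)

text \<open>Conjugation reverses the orientation, so the vertices are read as \<open>A\<close>,
  \<open>D\<close>, \<open>C\<close>, \<open>B\<close>; this fixes \<open>a\<close> and
  \<open>c\<close> and exchanges \<open>b\<close> and \<open>d\<close>.\<close>

lemma mirror:
  "near_square_quad (cnj A) (cnj D) (cnj C) (cnj B) (- \<i> * cnj \<omega> * cis a) l3 l2 l1 l0 a d c b"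
proof
  show "cmod (- \<i> * cnj \<omega> * cis a) = 1"
    using norm_\<omega> by (simp add: norm_mult)
  have "cnj D - cnj A = - cnj (A - D)"
    by simp
  also have "\<dots> = - \<i> * cnj \<omega> * cis a * l3"
    unfolding DA by (simp add: cis_cnj)
  finally show "cnj D - cnj A = - \<i> * cnj \<omega> * cis a * l3" .
  have *: "cis a * cis (- d) = cis (b + c)" "cis a * cis (- d - c) = cis b" "cis a * cis (- a) = 1"
    by (simp_all add: cis_mult sum)
  have "cnj C - cnj D = - cnj (D - C)"
    by simp
  also have "\<dots> = cnj \<omega> * cis (b + c) * l2"
    unfolding CD by (simp add: cis_cnj add.commute)
  finally show "cnj C - cnj D = - \<i> * cnj \<omega> * cis a * \<i> * cis (- d) * complex_of_real l2"
    by (simp add: algebra_simps flip: *)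
  have "cnj B - cnj C = - cnj (C - B)"
    by simp
  also have "\<dots> = \<i> * cnj \<omega> * cis b * l1"
    unfolding BC by (simp add: cis_cnj)
  finally show "cnj B - cnj C = - (- \<i> * cnj \<omega> * cis a * cis (- d - c) * complex_of_real l1)"
    by (simp add: algebra_simps flip: *)
  have "cnj A - cnj B = - cnj (B - A)"
    by simp
  also have "\<dots> = - (cnj \<omega> * (cis a * cis (- a)) * l0)"
    unfolding AB * by simp
  finally show "cnj A - cnj B = - (- \<i> * cnj \<omega> * cis a * \<i> * cis (- a) * complex_of_real l0)"
    by (simp add: algebra_simps)
  show "a = d + c + b"
    using sum by simp
qed (use small l0 l1 l2 l3 in auto)

lemma \<omega>_cnj: "\<omega> * cnj \<omega> = 1" "cnj \<omega> * \<omega> = 1"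
  using norm_\<omega> by (simp_all add: mult.commute [of "cnj \<omega>"] flip: complex_norm_square)

lemma positive: "0 < l0" "0 < l1" "0 < l2" "0 < l3"
  using l0 l1 l2 l3 by auto

lemma cross_AB: "cross A B C = l0 * l1 * cos b" "cross A B D = l0 * l3 * cos a"
proof -
  have "cnj (B - A) * (C - A) = cnj (B - A) * (C - B) + cnj (B - A) * (B - A)"
    by (simp add: algebra_simps)
  also have "\<dots> = (cnj \<omega> * \<omega>) * (l0 * \<i> * cis (- b) * l1 + l0 * l0)"
    unfolding AB BC by (simp add: algebra_simps)
  finally show "cross A B C = l0 * l1 * cos b"
    by (simp add: cross_def \<omega>_cnj)
  have "cnj (B - A) * (D - A) = - (cnj (B - A) * (A - D))"
    by (simp add: algebra_simps)
  also have "\<dots> = (cnj \<omega> * \<omega>) * (l0 * \<i> * cis (- a) * l3)"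
    unfolding AB DA by (simp add: algebra_simps)
  finally show "cross A B D = l0 * l3 * cos a"
    by (simp add: cross_def \<omega>_cnj)
qed

lemma cross_AB_pos: "0 < cross A B C" "0 < cross A B D"
  using cos_ge_9_10 [of a] cos_ge_9_10 [of b] small positive unfolding cross_AB
  by (auto intro!: mult_pos_pos)

text \<open>The computation for the side \<open>AB\<close> is transported to the other three sides
  by cyclic relabelling.\<close>

lemma convex: "convex_sides (sides A B C D)"
proof -
  interpret B: near_square_quad B C D A "\<omega> * \<i> * cis (- b)" l1 l2 l3 l0 "- b" c d "- a"
    by (rule shift)
  interpret C: near_square_quad C D A B "\<omega> * \<i> * cis (- b) * \<i> * cis (- c)" l2 l3 l0 l1 "- c" d "- a" b
    using B.shift by simp
  interpret D: near_square_quad D A B C "\<omega> * \<i> * cis (- b) * \<i> * cis (- c) * \<i> * cis (- d)" l3 l0 l1 l2 "- d" "- a" b c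
    using C.shift by simp
  show ?thesis
    using cross_AB_pos B.cross_AB_pos C.cross_AB_pos D.cross_AB_pos
    unfolding convex_sides_def sides_def by auto
qed

text \<open>A line is given by its angle with \<open>AB\<close> and the height of \<open>A\<close>
  over it, because bounces off the sides at \<open>A\<close> just negate this height.\<close>

definition K :: "real \<Rightarrow> real \<Rightarrow> complex \<times> real" where
  "K \<psi> y = (\<omega> * cis \<psi>, Im (cnj (\<omega> * cis \<psi>) * A) - y)"

lemma fst_K [simp]: "fst (K \<psi> y) = \<omega> * cis \<psi>"
  by (simp add: K_def)

lemma ht_K: "ht (K \<psi> y) z = Im (cis (- \<psi>) * (cnj \<omega> * (z - A))) + y"
  by (simp add: ht_def K_def cis_cnj algebra_simps)

lemma ht_K_A [simp]: "ht (K \<psi> y) A = y"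
  by (simp add: ht_K)

lemma ht_K_B [simp]: "ht (K \<psi> y) B = y - l0 * sin \<psi>"
proof -
  have "cnj \<omega> * (B - A) = (cnj \<omega> * \<omega>) * l0"
    unfolding AB by simp
  then show ?thesis
    by (simp add: ht_K \<omega>_cnj)
qed

lemma ht_K_C [simp]: "ht (K \<psi> y) C = y - l0 * sin \<psi> + l1 * cos (b + \<psi>)"
proof -
  have "cnj \<omega> * (C - A) = cnj \<omega> * (C - B) + cnj \<omega> * (B - A)"
    by (simp add: algebra_simps)
  also have "\<dots> = (cnj \<omega> * \<omega>) * (\<i> * cis (- b) * l1 + l0)"
    unfolding AB BC by (simp add: algebra_simps)
  finally show ?thesis
    by (simp add: ht_K \<omega>_cnj cos_add algebra_simps)
qed

lemma ht_K_D [simp]: "ht (K \<psi> y) D = y + l3 * cos (a + \<psi>)"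
proof -
  have "cnj \<omega> * (D - A) = - (cnj \<omega> * (A - D))"
    by (simp add: algebra_simps)
  also have "\<dots> = (cnj \<omega> * \<omega>) * (\<i> * cis (- a) * l3)"
    unfolding DA by (simp add: algebra_simps)
  finally show ?thesis
    by (simp add: ht_K \<omega>_cnj cos_add algebra_simps)
qed

lemma norm_K: "cmod (fst (K \<psi> y)) = 1"
  by (simp add: norm_mult norm_\<omega>)

lemma K_periodic: "K (\<psi> + 2 * pi) y = K \<psi> y"
  by (simp add: K_def flip: cis_mult)

lemma uminus_K: "- K \<psi> y = K (\<psi> + pi) (- y)"
  by (simp add: K_def flip: cis_mult)

abbreviation "S \<equiv> sides A B C D"

text \<open>The new offset may be read off at either end of the side: near \<open>AB\<close> the
  height of \<open>B\<close> is followed, near the diagonal that of \<open>C\<close>.\<close>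

lemma bounceI:
  assumes "(P, Q) \<in> S" "sgn (Q - P) = \<omega> * v" "ht (K \<psi> y) P < 0" "0 < ht (K \<psi> y) Q"
    and "cis \<psi>' = v\<^sup>2 * cis (- \<psi>)"
    and "ht (K \<psi>' y') P = - ht (K \<psi> y) P \<or> ht (K \<psi>' y') Q = - ht (K \<psi> y) Q"
  shows "bounce S (K \<psi> y) (K \<psi>' y')"
proof -
  have "(sgn (Q - P))\<^sup>2 * cnj (fst (K \<psi> y)) = \<omega> * (\<omega> * cnj \<omega>) * (v\<^sup>2 * cis (- \<psi>))"
    by (simp add: assms(2) cis_cnj power2_eq_square algebra_simps)
  then have fst: "fst (K \<psi>' y') = (sgn (Q - P))\<^sup>2 * cnj (fst (K \<psi> y))"
    by (simp add: \<omega>_cnj assms(5))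
  have "(sgn (P - Q))\<^sup>2 = (sgn (Q - P))\<^sup>2"
    by (metis minus_diff_eq power2_minus sgn_minus)
  then have "ht (K \<psi>' y') P = - ht (K \<psi> y) P"
    using assms(6) ht_reflect [of "K \<psi>' y'" P Q "K \<psi> y"] fst by auto
  then show ?thesis
    unfolding bounce_def using assms(1,3,4) fst norm_K by blast
qed

lemma sgn_unit: "cmod v = 1 \<Longrightarrow> 0 < l \<Longrightarrow> sgn (\<omega> * v * complex_of_real l) = \<omega> * v"
  by (simp add: sgn_eq norm_mult norm_\<omega>)

lemma bounce_AB:
  assumes "y < 0" "0 < y - l0 * sin \<psi>"
  shows "bounce S (K \<psi> y) (K (- \<psi>) (- y))"
proof (rule bounceI)
  show "(A, B) \<in> S"
    by (simp add: sides_def)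
  show "sgn (B - A) = \<omega> * 1"
    using sgn_unit [of 1 l0] positive by (simp add: AB)
qed (use assms in auto)

lemma bounce_BC:
  assumes "ht (K \<psi> y) B < 0" "0 < ht (K \<psi> y) C"
    and "ht (K (pi - 2 * b - \<psi>) y') B = - ht (K \<psi> y) B \<or> ht (K (pi - 2 * b - \<psi>) y') C = - ht (K \<psi> y) C"
  shows "bounce S (K \<psi> y) (K (pi - 2 * b - \<psi>) y')"
proof (rule bounceI)
  show "(B, C) \<in> S"
    by (simp add: sides_def)
  show "sgn (C - B) = \<omega> * (\<i> * cis (- b))"
    using sgn_unit [of "\<i> * cis (- b)" l1] positive by (simp add: BC norm_mult mult.assoc)
  have "cis (pi - 2 * b - \<psi>) = cis pi * (cis (- b) * cis (- b)) * cis (- \<psi>)"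
    by (simp only: cis_mult) (simp add: algebra_simps)
  then show "cis (pi - 2 * b - \<psi>) = (\<i> * cis (- b))\<^sup>2 * cis (- \<psi>)"
    by (simp add: power2_eq_square algebra_simps)
qed (use assms in auto)

lemma bounce_CD:
  assumes "ht (K \<psi> y) C < 0" "0 < ht (K \<psi> y) D"
    and "ht (K (- 2 * b - 2 * c - \<psi>) y') C = - ht (K \<psi> y) C"
  shows "bounce S (K \<psi> y) (K (- 2 * b - 2 * c - \<psi>) y')"
proof (rule bounceI)
  show "(C, D) \<in> S"
    by (simp add: sides_def)
  show "sgn (D - C) = \<omega> * (- cis (- b - c))"
    using sgn_unit [of "- cis (- b - c)" l2] positive by (simp add: CD norm_mult mult.assoc)
  have "- 2 * b - 2 * c - \<psi> = - b - c + (- b - c) + - \<psi>"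
    by simp
  then have "cis (- 2 * b - 2 * c - \<psi>) = (cis (- b - c) * cis (- b - c)) * cis (- \<psi>)"
    by (simp only: cis_mult)
  then show "cis (- 2 * b - 2 * c - \<psi>) = (- cis (- b - c))\<^sup>2 * cis (- \<psi>)"
    by (simp only: power2_eq_square minus_mult_minus)
qed (use assms in auto)

lemma bounce_DA:
  assumes "ht (K \<psi> y) D < 0" "0 < y"
  shows "bounce S (K \<psi> y) (K (pi - 2 * a - \<psi>) (- y))"
proof (rule bounceI)
  show "(D, A) \<in> S"
    by (simp add: sides_def)
  show "sgn (A - D) = \<omega> * (- (\<i> * cis (- a)))"
    using sgn_unit [of "- (\<i> * cis (- a))" l3] positive by (simp add: DA norm_mult mult.assoc)
  have "cis (pi - 2 * a - \<psi>) = cis pi * (cis (- a) * cis (- a)) * cis (- \<psi>)"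
    by (simp only: cis_mult) (simp add: algebra_simps)
  then show "cis (pi - 2 * a - \<psi>) = (- (\<i> * cis (- a)))\<^sup>2 * cis (- \<psi>)"
    by (simp add: power2_eq_square algebra_simps)
qed (use assms in auto)

text \<open>\<open>R \<theta>\<close> and \<open>L \<theta>\<close> are lines making the angle \<open>\<theta>\<close> with \<open>AB\<close>, running towards \<open>BC\<close> and towards
  \<open>DA\<close> respectively.\<close>

definition R :: "real \<Rightarrow> real \<Rightarrow> complex \<times> real" where "R \<theta> = K \<theta>"
definition L :: "real \<Rightarrow> real \<Rightarrow> complex \<times> real" where "L \<theta> = K (pi - \<theta>)"

lemma uminus_R: "- R \<theta> y = L (- \<theta>) (- y)"
  by (simp add: R_def L_def uminus_K add.commute)

lemma uminus_L: "- L \<theta> y = R (- \<theta>) (- y)"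
  using K_periodic [of "- \<theta>" "- y"] by (simp add: R_def L_def uminus_K algebra_simps)

lemma bounce_R_AB:
  assumes "y < 0" "0 < y - l0 * sin \<theta>" "\<theta>' = - \<theta>" "y' = - y"
  shows "bounce S (R \<theta> y) (R \<theta>' y')"
  using bounce_AB assms by (simp add: R_def)

text \<open>The equation for \<open>y'\<close> expresses that the height of \<open>B\<close> changes
  sign.\<close>

lemma bounce_R_BC:
  assumes "y - l0 * sin \<theta> < 0" "0 < y - l0 * sin \<theta> + l1 * cos (b + \<theta>)"
    and "\<theta>' = \<theta> + 2 * b" "y' = - y + l0 * sin \<theta> + l0 * sin \<theta>'"
  shows "bounce S (R \<theta> y) (L \<theta>' y')"
proof -
  have *: "pi - 2 * b - \<theta> = pi - \<theta>'"
    using assms by simp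
  show ?thesis
    unfolding R_def L_def using bounce_BC [of \<theta> y y', unfolded *] assms(1,2,4) by simp
qed

lemma bounce_L_DA:
  assumes "y - l3 * cos (a - \<theta>) < 0" "0 < y" "\<theta>' = \<theta> - 2 * a" "y' = - y"
  shows "bounce S (L \<theta> y) (R \<theta>' y')"
proof -
  have "cos (a + (pi - \<theta>)) = - cos (a - \<theta>)"
    using cos_periodic_pi [of "a - \<theta>"] by (simp add: algebra_simps)
  then show ?thesis
    using bounce_DA [of "pi - \<theta>" y] assms by (simp add: R_def L_def)
qed

end

section \<open>Paths near a side\<close>

lemma sin_diff_sin':
  fixes x y u v :: real
  assumes "x - y = 2 * u" "x + y = 2 * v"
  shows "sin x - sin y = 2 * (sin u * cos v)"
  using assms by (simp add: sin_diff_sin)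

lemma sin_plus_sin':
  fixes x y u v :: real
  assumes "x + y = 2 * u" "x - y = 2 * v"
  shows "sin x + sin y = 2 * (sin u * cos v)"
  using assms by (simp add: sin_plus_sin)

text \<open>The sum is \<open>2 * cos a * (sin (2 * b) - sin (2 * a - 4 * b))\<close>, and
  \<open>2 * b < 2 * a - 4 * b\<close> means \<open>3 * b < a\<close>.\<close>

lemma sin_sum_neg:
  fixes a b :: real
  assumes "0 < b" "3 * b < a" "a \<le> 0.059"
  shows "sin (a + 2 * b) - sin (a - 2 * b) + sin (4 * b - a) - sin (3 * a - 4 * b) < 0"
proof -
  have "sin (2 * b) < sin (2 * a - 4 * b)"
    using assms pi_gt3 by (intro sin_monotone_2pi) auto
  moreover have "0.9 \<le> cos a"
    using assms by (intro cos_ge_9_10) simp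
  ultimately have "cos a * (sin (2 * b) - sin (2 * a - 4 * b)) < 0"
    by (intro mult_pos_neg) auto
  moreover have "sin (a + 2 * b) - sin (a - 2 * b) = 2 * (sin (2 * b) * cos a)"
    by (rule sin_diff_sin') simp_all
  moreover have "sin (3 * a - 4 * b) - sin (4 * b - a) = 2 * (sin (2 * a - 4 * b) * cos a)"
    by (rule sin_diff_sin') simp_all
  ultimately show ?thesis
    by (simp add: algebra_simps)
qed

text \<open>The common factor is \<open>2 * sin (2 * b)\<close>; the cofactor is a sum of cosines of
  small angles.\<close>

lemma sin_sum_pos:
  fixes a b :: real
  assumes "0 < b" "3 * b < a" "a \<le> 0.059"
  shows "0 < sin a + sin (a + 2 * b) - sin (a - 2 * b) + sin (4 * b - a)"
proof -
  have "0.9 \<le> cos a" "0.9 \<le> cos (a - 2 * b)"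
    using assms by (intro cos_ge_9_10; simp)+
  moreover have "0 < sin (2 * b)"
    using assms pi_gt3 by (intro sin_gt_zero) auto
  ultimately have "0 < sin (2 * b) * (cos a + cos (a - 2 * b))"
    by simp
  moreover have "sin (a + 2 * b) - sin (a - 2 * b) = 2 * (sin (2 * b) * cos a)"
    by (rule sin_diff_sin') simp_all
  moreover have "sin a + sin (4 * b - a) = 2 * (sin (2 * b) * cos (a - 2 * b))"
    by (rule sin_plus_sin') simp_all
  ultimately show ?thesis
    by (simp add: algebra_simps)
qed

text \<open>Pairing the six sines gives the common factor \<open>2 * sin (3 * b - a)\<close>, which
  is where \<open>a < 3 * b\<close> enters.\<close>

lemma sin_sum_pos':
  fixes a b :: real
  assumes "2 * b < a" "a < 3 * b" "a \<le> 0.059"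
  shows "0 < sin a + sin (a + 2 * b) - sin (a - 2 * b) + sin (4 * b - a) - sin (3 * a - 4 * b) - sin (3 * a - 6 * b)"
proof -
  have "0.9 \<le> cos b" "0.9 \<le> cos (2 * a - b)" "0.9 \<le> cos (2 * a - 3 * b)"
    using assms by (intro cos_ge_9_10; simp)+
  moreover have "0 < sin (3 * b - a)"
    using assms pi_gt3 by (intro sin_gt_zero) auto
  ultimately have "0 < sin (3 * b - a) * (cos b + cos (2 * a - b) + cos (2 * a - 3 * b))"
    by simp
  moreover have "sin a - sin (3 * a - 6 * b) = 2 * (sin (3 * b - a) * cos (2 * a - 3 * b))"
    by (rule sin_diff_sin') simp_all
  moreover have "sin (a + 2 * b) - sin (3 * a - 4 * b) = 2 * (sin (3 * b - a) * cos (2 * a - b))"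
    by (rule sin_diff_sin') simp_all
  moreover have "sin (4 * b - a) - sin (a - 2 * b) = 2 * (sin (3 * b - a) * cos b)"
    by (rule sin_diff_sin') simp_all
  ultimately show ?thesis
    by (simp add: algebra_simps)
qed

text \<open>Here the common factor is \<open>- 2 * sin (2 * a - 4 * b)\<close>, which is where
  \<open>2 * b < a\<close> enters.\<close>

lemma sin_sum_neg':
  fixes a b :: real
  assumes "2 * b < a" "a < 3 * b" "a \<le> 0.059"
  shows "sin (a + 2 * b) - sin (a - 2 * b) + sin (4 * b - a) - sin (3 * a - 4 * b) - sin (3 * a - 6 * b)
    - sin (5 * a - 6 * b) < 0"
proof -
  have "0.9 \<le> cos a" "0.9 \<le> cos (3 * a - 2 * b)" "0.9 \<le> cos (a - 2 * b)"
    using assms by (intro cos_ge_9_10; simp)+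
  moreover have "0 < sin (2 * a - 4 * b)"
    using assms pi_gt3 by (intro sin_gt_zero) auto
  ultimately have "0 < sin (2 * a - 4 * b) * (cos a + cos (3 * a - 2 * b) + cos (a - 2 * b))"
    by simp
  moreover have "sin (5 * a - 6 * b) - sin (a + 2 * b) = 2 * (sin (2 * a - 4 * b) * cos (3 * a - 2 * b))"
    by (rule sin_diff_sin') simp_all
  moreover have "sin (3 * a - 6 * b) + sin (a - 2 * b) = 2 * (sin (2 * a - 4 * b) * cos (a - 2 * b))"
    by (rule sin_plus_sin') simp_all
  moreover have "sin (3 * a - 4 * b) - sin (4 * b - a) = 2 * (sin (2 * a - 4 * b) * cos a)"
    by (rule sin_diff_sin') simp_all
  ultimately show ?thesis
    by (simp add: algebra_simps)
qed

context near_square_quad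
begin

text \<open>The longest half path below consists of 14 lines, whence the bound 28.\<close>

lemma closed_path_of_palindrome':
  assumes "xs \<noteq> []" "length xs \<le> 14" "successively (bounce S) xs"
    "bounce S (- hd xs) (hd xs)" "bounce S (last xs) (- last xs)"
  shows "has_closed_path S 28"
  using assms by (intro closed_path_of_palindrome [OF convex]) auto

lemma rectangle:
  assumes "a = 0" "b = 0" "c = 0"
  shows "has_closed_path S 28"
proof (rule closed_path_of_palindrome')
  \<comment> \<open>The perpendicular to \<open>AB\<close> through its midpoint.\<close>
  let ?l = "K (pi / 2) (l0 / 2)"
  have m: "- ?l = K (- pi / 2) (- (l0 / 2))"
    unfolding uminus_K using K_periodic [of "- pi / 2" "- (l0 / 2)"] by simp
  show "bounce S (- hd [?l]) (hd [?l])"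
    using bounce_AB [of "- (l0 / 2)" "- pi / 2"] positive by (simp add: m)
  show "bounce S (last [?l]) (- last [?l])"
    using bounce_CD [of "pi / 2" "l0 / 2" "- (l0 / 2)"] positive assms by (simp add: m)
qed auto

text \<open>This is the orthic (Fagnano) triangle of the triangle cut out by the lines \<open>DA, AB, BC\<close>.\<close>

lemma adjacent_acute:
  assumes "0 < a" "b < 0"
  shows "has_closed_path S 28"
proof (rule closed_path_of_list [OF convex])
  \<comment> \<open>The three lines close up if the height of \<open>A\<close> is the same before
    and after \<open>BC\<close>, that is,
    \<open>2 * y = l0 * (sin (a - b) + sin (a + b))\<close>.\<close>
  define y where "y = l0 * (sin a * cos b)"
  let ?xs = "[R (a - b) y, L (a + b) y, R (b - a) (- y)]"
  have s: "0 < sin a" "sin b < 0"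
    using assms small pi_gt3 sin_gt_zero [of a] sin_gt_zero [of "- b"] by auto
  have c: "0.9 \<le> cos a" "0.9 \<le> cos b"
    using small by (intro cos_ge_9_10; simp)+
  have sl: "\<bar>sin a\<bar> \<le> 0.1" "\<bar>sin b\<bar> \<le> 0.1"
    using abs_sin_le [of a] abs_sin_le [of b] small by simp_all
  have y: "0 < y"
    using s c positive by (simp add: y_def)
  have neg: "l0 * (cos a * sin b) < 0"
    using s c positive by (simp add: mult_less_0_iff)
  have y1: "y - l0 * sin (a - b) = l0 * (cos a * sin b)" "- y - l0 * sin (b - a) = - (l0 * (cos a * sin b))"
    by (simp_all add: y_def sin_diff algebra_simps)
  have "\<bar>l0 * sin b\<bar> \<le> 1 * 0.1" "\<bar>l0 * sin a\<bar> \<le> 1 * 0.1"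
    unfolding abs_mult using l0 sl by (intro mult_mono; simp)+
  then have "0 < l1 + l0 * sin b" "l0 * sin a - l3 < 0"
    using l1 l3 by (simp_all add: abs_le_iff)
  then have "0 < (l1 + l0 * sin b) * cos a" "(l0 * sin a - l3) * cos b < 0"
    using c by (auto intro!: mult_pos_pos mult_neg_pos)
  then have far: "0 < l0 * (cos a * sin b) + l1 * cos a" "y - l3 * cos b < 0"
    by (simp_all add: y_def algebra_simps)
  have "y = - y + l0 * sin (a - b) + l0 * sin (a + b)"
    by (simp add: y_def sin_diff sin_add algebra_simps)
  then have "bounce S (R (a - b) y) (L (a + b) y)"
    using neg far by (intro bounce_R_BC) (simp_all add: y1)
  moreover have "bounce S (L (a + b) y) (R (b - a) (- y))"
    using y far by (intro bounce_L_DA) simp_all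
  moreover have "bounce S (R (b - a) (- y)) (R (a - b) y)"
    using y neg by (intro bounce_R_AB) (simp_all add: y1)
  ultimately show "successively (bounce S) ?xs" "bounce S (last ?xs) (hd ?xs)"
    by simp_all
qed auto

text \<open>For small positive angles, \<open>l0 * sin\<close> and the distances of the far vertices are bounded
  linearly, which reduces the conditions of all bounces below to linear arithmetic.\<close>

lemma l0_sin:
  assumes "0 < x" "x < 1"
  shows "0 < l0 * sin x" "l0 * sin x \<le> 0.73 * x"
proof -
  have "0 < sin x"
    using assms pi_gt3 by (intro sin_gt_zero) auto
  then show "0 < l0 * sin x"
    using positive by simp
  have "l0 * sin x \<le> 0.73 * x"
    using l0 \<open>0 < sin x\<close> assms by (intro mult_mono sin_x_le_x) auto
  then show "l0 * sin x \<le> 0.73 * x" .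
qed

lemma far_vertex:
  assumes "\<bar>x\<bar> \<le> 0.4"
  shows "0.6 < l1 * cos x" "0.6 < l3 * cos x"
proof -
  have "0.68 * 0.9 \<le> l1 * cos x" "0.68 * 0.9 \<le> l3 * cos x"
    using cos_ge_9_10 [OF assms] l1 l3 by (intro mult_mono; simp)+
  then show "0.6 < l1 * cos x" "0.6 < l3 * cos x"
    by simp_all
qed

text \<open>\<open>C\<close> is more than 0.6 higher than \<open>B\<close>, so a depth of at most
  0.6 for \<open>B\<close> already puts \<open>C\<close> on the left.\<close>

lemma bounce_R_BC':
  assumes "y < l0 * sin \<theta>" "l0 * sin \<theta> - y \<le> 0.6" "\<bar>b + \<theta>\<bar> \<le> 0.4"
    and "\<theta>' = \<theta> + 2 * b" "y' = - y + l0 * sin \<theta> + l0 * sin \<theta>'"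
  shows "bounce S (R \<theta> y) (L \<theta>' y')"
  using far_vertex [OF assms(3)] assms by (intro bounce_R_BC) simp_all

lemma bounce_L_DA':
  assumes "0 < y" "y \<le> 0.6" "\<bar>a - \<theta>\<bar> \<le> 0.4" "\<theta>' = \<theta> - 2 * a" "y' = - y"
  shows "bounce S (L \<theta> y) (R \<theta>' y')"
  using far_vertex [OF assms(3)] assms by (intro bounce_L_DA) simp_all

text \<open>The direction \<open>L a\<close> is perpendicular to \<open>DA\<close>: the bounce
  changes the angle \<open>a\<close> to \<open>a - 2 * a = - a\<close>, which is its
  reversal.\<close>

lemma start_DA:
  assumes "0 < h" "h \<le> 0.6"
  shows "bounce S (- R (- a) (- h)) (R (- a) (- h))"
  unfolding uminus_R using assms by (intro bounce_L_DA') simp_all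

lemma stop_DA:
  assumes "0 < y" "y \<le> 0.6"
  shows "bounce S (L a y) (- L a y)"
  unfolding uminus_L using assms by (intro bounce_L_DA') simp_all

text \<open>Since \<open>BC\<close> is perpendicular to \<open>AB\<close>, the bounce off it keeps
  the angle \<open>a\<close>, so the path returns to \<open>DA\<close> perpendicularly.\<close>

lemma right_B:
  assumes "0 < a" "b = 0"
  shows "has_closed_path S 28"
proof -
  define h where "h = l0 * sin a / 2"
  have h: "0 < h" "h \<le> 0.03" "l0 * sin a = 2 * h"
    using l0_sin [of a] assms small by (simp_all add: h_def)
  let ?xs = "[R (- a) (- h), R a h, L a (3 * h)]"
  have "bounce S (R (- a) (- h)) (R a h)"
    using h by (intro bounce_R_AB) simp_all
  moreover have "bounce S (R a h) (L a (3 * h))"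
    using h assms small by (intro bounce_R_BC') simp_all
  ultimately show ?thesis
    using h by (intro closed_path_of_palindrome' [of ?xs]) (simp_all add: start_DA stop_DA)
qed

text \<open>The path is perpendicular to \<open>DA\<close> at one end and to \<open>BC\<close> at the other.\<close>

lemma obtuse_B_three:
  assumes "0 < b" "a = 3 * b"
  shows "has_closed_path S 28"
proof -
  define h where "h = l0 * sin a / 2"
  define s where "s = l0 * sin (5 * b)"
  have h: "0 < h" "h \<le> 0.03" "l0 * sin a = 2 * h"
    using l0_sin [of a] assms small by (simp_all add: h_def)
  have s: "0 < s" "s \<le> 0.1"
    using l0_sin [of "5 * b"] assms small by (simp_all add: s_def)
  have "sin b < sin (5 * b)"
    using assms small pi_gt3 by (intro sin_monotone_2pi) auto
  then have sb: "0 < l0 * sin b" "l0 * sin b < s"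
    using l0_sin [of b] assms small positive by (simp_all add: s_def)
  define y where "y = h + s"
  \<comment> \<open>The angle after \<open>BC\<close> is \<open>a + 2 * b = 5 * b\<close>, and after
    \<open>DA\<close> it is \<open>5 * b - 2 * a = - b\<close>, perpendicular to
    \<open>BC\<close>.\<close>
  let ?xs = "[R (- a) (- h), R a h, L (5 * b) y, R (- b) (- y)]"
  have "bounce S (R (- a) (- h)) (R a h)"
    using h by (intro bounce_R_AB) simp_all
  moreover have "bounce S (R a h) (L (5 * b) y)"
    using h assms small by (intro bounce_R_BC') (simp_all add: s_def y_def)
  moreover have "bounce S (L (5 * b) y) (R (- b) (- y))"
    using h s assms small by (intro bounce_L_DA') (simp_all add: y_def)
  moreover have "bounce S (R (- b) (- y)) (- R (- b) (- y))"
    unfolding uminus_R using h s sb by (intro bounce_R_BC') (simp_all add: y_def)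
  ultimately show ?thesis
    using h by (intro closed_path_of_palindrome' [of ?xs]) (simp_all add: start_DA)
qed

text \<open>The path leaves \<open>DA\<close> perpendicularly at height \<open>h\<close> above \<open>A\<close>, hits
  \<open>AB, (BC, DA)\<^sup>2, AB, BC, DA, BC\<close> and meets \<open>DA\<close> perpendicularly again. In the unfolding along it,
  \<open>A1, A3, A5, A7\<close> are the heights of the images of \<open>A\<close>, and \<open>h\<close> has to separate the vertices above
  the path from those below it.\<close>

lemma obtuse_B_more:
  assumes "0 < b" "3 * b < a"
  shows "has_closed_path S 28"
proof -
  define s1 where "s1 = l0 * sin a"
  define s2 where "s2 = l0 * sin (a + 2 * b)"
  define s3 where "s3 = l0 * sin (a - 2 * b)"
  define s4 where "s4 = l0 * sin (4 * b - a)"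
  define s5 where "s5 = l0 * sin (3 * a - 4 * b)"
  define s6 where "s6 = l0 * sin (3 * a - 2 * b)"
  note defs = s1_def s2_def s3_def s4_def s5_def s6_def
  have neg: "l0 * sin (2 * b - a) = - s3" "l0 * sin (4 * b - 3 * a) = - s5"
    unfolding defs by (simp_all flip: mult_minus_right sin_minus)
  have s: "0 < s1" "s1 \<le> 0.73 * a" "0 < s2" "s2 \<le> 0.73 * (a + 2 * b)" "0 < s3" "s3 \<le> 0.73 * (a - 2 * b)"
    "0 < s5" "s5 \<le> 0.73 * (3 * a - 4 * b)" "0 < s6" "s6 \<le> 0.73 * (3 * a - 2 * b)"
    unfolding defs using assms small by (intro l0_sin; simp)+
  \<comment> \<open>The sign of \<open>4 * b - a\<close> is not determined here, so only the
    absolute value of \<open>s4\<close> is bounded.\<close>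
  have "\<bar>s4\<bar> \<le> 1 * \<bar>4 * b - a\<bar>"
    unfolding s4_def abs_mult using l0 by (intro mult_mono abs_sin_le) auto
  then have s4: "\<bar>s4\<bar> \<le> a"
    using assms by (simp add: abs_if split: if_splits)
  have s23: "s3 < s2"
    unfolding defs using assms small positive pi_gt3 by (intro mult_strict_left_mono sin_monotone_2pi) auto
  have "l0 * (sin (a + 2 * b) - sin (a - 2 * b) + sin (4 * b - a) - sin (3 * a - 4 * b)) < 0"
    using sin_sum_neg [of b a] assms small positive by (simp add: mult_less_0_iff)
  then have *: "s2 - s3 + s4 - s5 < 0"
    by (simp add: defs algebra_simps)
  have "0 < l0 * (sin a + sin (a + 2 * b) - sin (a - 2 * b) + sin (4 * b - a))"
    using sin_sum_pos [of b a] assms small positive by simp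
  then have **: "0 < s1 + s2 - s3 + s4"
    by (simp add: defs algebra_simps)
  define A1 where "A1 = s1 + s2"
  define A3 where "A3 = A1 - s3 + s4"
  define A5 where "A5 = A3 - s5 - s6"
  define A7 where "A7 = A5 - s3 - s1"
  note heights = A1_def A3_def A5_def A7_def
  \<comment> \<open>The bounds say that both hits on \<open>AB\<close> fall between \<open>A\<close>
    and \<open>B\<close>. The two nontrivial comparisons are \<open>A3 - s5 < s1\<close>, which is
    \<open>*\<close>, and \<open>0 < A3\<close>, which is \<open>**\<close>.\<close>
  obtain h where h: "0 < h" "A3 - s5 < h" "h < s1" "h < A3"
    using dense [of "max 0 (A3 - s5)" "min s1 A3"] s * ** by (auto simp: heights)
  have bd: "0 < a" "a \<le> 0.059"
    using assms small by auto
  let ?xs = "[R (- a) (- h), R a h, L (a + 2 * b) (A1 - h), R (2 * b - a) (h - A1), L (4 * b - a) (A3 - h),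
    R (4 * b - 3 * a) (h - A3), R (3 * a - 4 * b) (A3 - h), L (3 * a - 2 * b) (h - A5),
    R (a - 2 * b) (A5 - h), L a (h - A7)]"
  have "bounce S (R (- a) (- h)) (R a h)"
    using h by (intro bounce_R_AB) (simp_all add: s1_def)
  moreover have "bounce S (R a h) (L (a + 2 * b) (A1 - h))"
    using h s bd assms by (intro bounce_R_BC') (simp_all add: heights flip: s1_def s2_def)
  moreover have "bounce S (L (a + 2 * b) (A1 - h)) (R (2 * b - a) (h - A1))"
    using h s bd assms by (intro bounce_L_DA') (simp_all add: heights)
  moreover have "bounce S (R (2 * b - a) (h - A1)) (L (4 * b - a) (A3 - h))"
    using h s s23 bd assms by (intro bounce_R_BC') (simp_all add: neg heights flip: s4_def)
  moreover have "bounce S (L (4 * b - a) (A3 - h)) (R (4 * b - 3 * a) (h - A3))"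
    using h s s4 bd assms by (intro bounce_L_DA') (simp_all add: heights)
  moreover have "bounce S (R (4 * b - 3 * a) (h - A3)) (R (3 * a - 4 * b) (A3 - h))"
    using h by (intro bounce_R_AB) (simp_all add: neg)
  moreover have "bounce S (R (3 * a - 4 * b) (A3 - h)) (L (3 * a - 2 * b) (h - A5))"
    using h s s4 bd assms by (intro bounce_R_BC') (simp_all add: heights flip: s5_def s6_def)
  moreover have "bounce S (L (3 * a - 2 * b) (h - A5)) (R (a - 2 * b) (A5 - h))"
    using h s s4 bd assms by (intro bounce_L_DA') (simp_all add: heights)
  moreover have "bounce S (R (a - 2 * b) (A5 - h)) (L a (h - A7))"
    using h s s4 bd assms by (intro bounce_R_BC') (simp_all add: heights flip: s3_def s1_def)
  moreover have "0 < h - A7" "h - A7 \<le> 0.6" "h \<le> 0.6"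
    using h s s4 bd assms by (simp_all add: heights)
  ultimately show ?thesis
    using h by (intro closed_path_of_palindrome' [of ?xs]) (simp_all add: start_DA stop_DA)
qed

text \<open>As before, along \<open>AB, (BC, DA)\<^sup>3, AB, (BC, DA)\<^sup>2, BC\<close>.\<close>

lemma obtuse_B_less:
  assumes "2 * b < a" "a < 3 * b"
  shows "has_closed_path S 28"
proof -
  define s1 where "s1 = l0 * sin a"
  define s2 where "s2 = l0 * sin (a + 2 * b)"
  define s3 where "s3 = l0 * sin (a - 2 * b)"
  define s4 where "s4 = l0 * sin (4 * b - a)"
  define s5 where "s5 = l0 * sin (3 * a - 4 * b)"
  define s6 where "s6 = l0 * sin (3 * a - 6 * b)"
  define s7 where "s7 = l0 * sin (5 * a - 6 * b)"
  define s8 where "s8 = l0 * sin (5 * a - 4 * b)"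
  define s9 where "s9 = l0 * sin (3 * a - 2 * b)"
  note defs = s1_def s2_def s3_def s4_def s5_def s6_def s7_def s8_def s9_def
  have neg: "l0 * sin (2 * b - a) = - s3" "l0 * sin (4 * b - 3 * a) = - s5"
    "l0 * sin (6 * b - 3 * a) = - s6" "l0 * sin (6 * b - 5 * a) = - s7"
    unfolding defs by (simp_all flip: mult_minus_right sin_minus)
  have s: "0 < s1" "s1 \<le> 0.73 * a" "0 < s2" "s2 \<le> 0.73 * (a + 2 * b)" "0 < s3" "s3 \<le> 0.73 * (a - 2 * b)"
    "0 < s4" "s4 \<le> 0.73 * (4 * b - a)"
    "0 < s5" "s5 \<le> 0.73 * (3 * a - 4 * b)" "0 < s6" "s6 \<le> 0.73 * (3 * a - 6 * b)"
    "0 < s7" "s7 \<le> 0.73 * (5 * a - 6 * b)" "0 < s8" "s8 \<le> 0.73 * (5 * a - 4 * b)"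
    "0 < s9" "s9 \<le> 0.73 * (3 * a - 2 * b)"
    unfolding defs using assms small by (intro l0_sin; simp)+
  have s23: "s3 < s2"
    unfolding defs using assms small positive pi_gt3 by (intro mult_strict_left_mono sin_monotone_2pi) auto
  have "l0 * (sin (a + 2 * b) - sin (a - 2 * b) + sin (4 * b - a) - sin (3 * a - 4 * b) - sin (3 * a - 6 * b)
      - sin (5 * a - 6 * b)) < 0"
    using sin_sum_neg' [of b a] assms small positive by (simp add: mult_less_0_iff)
  then have *: "s2 - s3 + s4 - s5 - s6 - s7 < 0"
    by (simp add: defs algebra_simps)
  have "0 < l0 * (sin a + sin (a + 2 * b) - sin (a - 2 * b) + sin (4 * b - a) - sin (3 * a - 4 * b)
      - sin (3 * a - 6 * b))"
    using sin_sum_pos' [of b a] assms small positive by simp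
  then have **: "0 < s1 + s2 - s3 + s4 - s5 - s6"
    by (simp add: defs algebra_simps)
  define A1 where "A1 = s1 + s2"
  define A3 where "A3 = A1 - s3 + s4"
  define A5 where "A5 = A3 - s5 - s6"
  define A7 where "A7 = A5 - s7 - s8"
  define A9 where "A9 = A7 - s5 - s9"
  define A11 where "A11 = A9 - s3 - s1"
  note heights = A1_def A3_def A5_def A7_def A9_def A11_def
  \<comment> \<open>Again the two hits on \<open>AB\<close>, the second now one round of
    \<open>BC\<close>, \<open>DA\<close> later: \<open>*\<close> gives \<open>A5 - s7 < s1\<close>
    and \<open>**\<close> gives \<open>0 < A5\<close>.\<close>
  obtain h where h: "0 < h" "A5 - s7 < h" "h < s1" "h < A5"
    using dense [of "max 0 (A5 - s7)" "min s1 A5"] s * ** by (auto simp: heights)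
  have bd: "0 < a" "a \<le> 0.059"
    using assms small by auto
  let ?xs = "[R (- a) (- h), R a h, L (a + 2 * b) (A1 - h), R (2 * b - a) (h - A1), L (4 * b - a) (A3 - h),
    R (4 * b - 3 * a) (h - A3), L (6 * b - 3 * a) (A5 - h), R (6 * b - 5 * a) (h - A5),
    R (5 * a - 6 * b) (A5 - h), L (5 * a - 4 * b) (h - A7), R (3 * a - 4 * b) (A7 - h),
    L (3 * a - 2 * b) (h - A9), R (a - 2 * b) (A9 - h), L a (h - A11)]"
  have "bounce S (R (- a) (- h)) (R a h)"
    using h by (intro bounce_R_AB) (simp_all add: s1_def)
  moreover have "bounce S (R a h) (L (a + 2 * b) (A1 - h))"
    using h s bd assms by (intro bounce_R_BC') (simp_all add: heights flip: s1_def s2_def)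
  moreover have "bounce S (L (a + 2 * b) (A1 - h)) (R (2 * b - a) (h - A1))"
    using h s bd assms by (intro bounce_L_DA') (simp_all add: heights)
  moreover have "bounce S (R (2 * b - a) (h - A1)) (L (4 * b - a) (A3 - h))"
    using h s s23 bd assms by (intro bounce_R_BC') (simp_all add: neg heights flip: s4_def)
  moreover have "bounce S (L (4 * b - a) (A3 - h)) (R (4 * b - 3 * a) (h - A3))"
    using h s s23 bd assms by (intro bounce_L_DA') (simp_all add: heights)
  moreover have "bounce S (R (4 * b - 3 * a) (h - A3)) (L (6 * b - 3 * a) (A5 - h))"
    using h s bd assms by (intro bounce_R_BC') (simp_all add: neg heights)
  moreover have "bounce S (L (6 * b - 3 * a) (A5 - h)) (R (6 * b - 5 * a) (h - A5))"
    using h s bd assms by (intro bounce_L_DA') (simp_all add: heights)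
  moreover have "bounce S (R (6 * b - 5 * a) (h - A5)) (R (5 * a - 6 * b) (A5 - h))"
    using h by (intro bounce_R_AB) (simp_all add: neg)
  moreover have "bounce S (R (5 * a - 6 * b) (A5 - h)) (L (5 * a - 4 * b) (h - A7))"
    using h s bd assms by (intro bounce_R_BC') (simp_all add: heights flip: s7_def s8_def)
  moreover have "bounce S (L (5 * a - 4 * b) (h - A7)) (R (3 * a - 4 * b) (A7 - h))"
    using h s bd assms by (intro bounce_L_DA') (simp_all add: heights)
  moreover have "bounce S (R (3 * a - 4 * b) (A7 - h)) (L (3 * a - 2 * b) (h - A9))"
    using h s bd assms by (intro bounce_R_BC') (simp_all add: heights flip: s5_def s9_def)
  moreover have "bounce S (L (3 * a - 2 * b) (h - A9)) (R (a - 2 * b) (A9 - h))"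
    using h s bd assms by (intro bounce_L_DA') (simp_all add: heights)
  moreover have "bounce S (R (a - 2 * b) (A9 - h)) (L a (h - A11))"
    using h s bd assms by (intro bounce_R_BC') (simp_all add: heights flip: s3_def s1_def)
  moreover have "0 < h - A11" "h - A11 \<le> 0.6" "h \<le> 0.6"
    using h s bd assms by (simp_all add: heights)
  ultimately show ?thesis
    using h by (intro closed_path_of_palindrome' [of ?xs]) (simp_all add: start_DA stop_DA)
qed

end

section \<open>Paths near a diagonal\<close>

context near_square_quad
begin

text \<open>In the frame with \<open>A = 0\<close> and \<open>AB\<close> on the real axis, \<open>C\<close> is \<open>r * cis \<eta>\<close>.\<close>

lemma diagonal:
  obtains r \<eta> where "0 < r" "\<And>\<psi> y. ht (K \<psi> y) C = y + r * sin (\<eta> - \<psi>)"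
    "\<And>t. \<bar>r * sin t\<bar> \<le> 1.1 * \<bar>t\<bar>"
    "\<And>t. \<bar>t\<bar> \<le> 0.3 \<Longrightarrow> 0.14 < l0 * sin (\<eta> + t)"
    "\<And>t. \<bar>t\<bar> \<le> 0.3 \<Longrightarrow> 0.14 < l1 * cos (\<eta> + t)"
    "\<And>t. \<bar>t\<bar> \<le> 0.3 \<Longrightarrow> 0.14 < l2 * sin (\<eta> + t)"
    "\<And>t. \<bar>t\<bar> \<le> 0.3 \<Longrightarrow> 0.14 < l3 * cos (\<eta> + t)"
proof -
  define r where "r = cmod (Complex (l0 + l1 * sin b) (l1 * cos b))"
  define \<eta> where "\<eta> = Arg (Complex (l0 + l1 * sin b) (l1 * cos b))"
  have "Complex (l0 + l1 * sin b) (l1 * cos b) = r * cis \<eta>"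
    by (metis r_def \<eta>_def cis_conv_exp complex_norm_eq_1_exp rcis_cmod_Arg rcis_def)
  then have X: "r * cos \<eta> = l0 + l1 * sin b" and Y: "r * sin \<eta> = l1 * cos b"
    by (auto simp: complex_eq_iff)
  have "\<bar>l1 * sin b\<bar> \<le> 0.73 * 0.059"
    unfolding abs_mult using l1 abs_sin_le [of b] small by (intro mult_mono) auto
  then have X2: "0.63 \<le> r * cos \<eta>" "r * cos \<eta> \<le> 0.78"
    unfolding X using l0 by (auto simp: abs_le_iff)
  have "b\<^sup>2 \<le> 0.059\<^sup>2"
    using small by (subst abs_le_square_iff [symmetric]) simp
  then have "0.99 \<le> cos b"
    using cos_ge_quadratic [of b] by (simp add: power2_eq_square)
  then have "0.68 * 0.99 \<le> l1 * cos b" "l1 * cos b \<le> 0.73 * 1"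
    using l1 by (intro mult_mono; simp)+
  then have Y2: "0.67 \<le> r * sin \<eta>" "r * sin \<eta> \<le> 0.73"
    unfolding Y by simp_all
  have r0: "0 \<le> r"
    by (simp add: r_def)
  have "r\<^sup>2 = (r * cos \<eta>)\<^sup>2 + (r * sin \<eta>)\<^sup>2"
    by (simp add: power_mult_distrib flip: distrib_left)
  also have "\<dots> \<le> 0.78\<^sup>2 + 0.73\<^sup>2"
    using X2 Y2 by (intro add_mono power_mono) auto
  also have "\<dots> \<le> 1.1\<^sup>2"
    by (simp add: power2_eq_square)
  finally have r: "r \<le> 1.1"
    by (rule power2_le_imp_le) simp
  have rp: "0 < r"
    using r0 X2 by (cases "r = 0") auto
  have "0.63 \<le> 1.1 * cos \<eta>" "0.67 \<le> 1.1 * sin \<eta>"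
  proof -
    have "0 < cos \<eta>" "0 < sin \<eta>"
      using X2 Y2 zero_less_mult_pos [OF _ rp, of "cos \<eta>"] zero_less_mult_pos [OF _ rp, of "sin \<eta>"]
      by simp_all
    then have "r * cos \<eta> \<le> 1.1 * cos \<eta>" "r * sin \<eta> \<le> 1.1 * sin \<eta>"
      using r by (auto intro!: mult_right_mono)
    then show "0.63 \<le> 1.1 * cos \<eta>" "0.67 \<le> 1.1 * sin \<eta>"
      using X2 Y2 by auto
  qed
  then have cs: "0.57 \<le> cos \<eta>" "0.57 \<le> sin \<eta>"
    by simp_all
  \<comment> \<open>The margin is \<open>0.57 * 0.9 - 0.3 = 0.213\<close>; multiplying 0.21 by the
    least side length 0.68 leaves more than 0.14.\<close>
  have low: "0.21 < cos (\<eta> + t)" "0.21 < sin (\<eta> + t)" if "\<bar>t\<bar> \<le> 0.3" for t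
  proof -
    have c: "0.9 \<le> cos t"
      using that by (intro cos_ge_9_10) simp
    have "\<bar>sin \<eta> * sin t\<bar> \<le> 1 * 0.3" "\<bar>cos \<eta> * sin t\<bar> \<le> 1 * 0.3"
      unfolding abs_mult using abs_sin_le [of t] that by (intro mult_mono; simp)+
    moreover have "0.57 * 0.9 \<le> cos \<eta> * cos t" "0.57 * 0.9 \<le> sin \<eta> * cos t"
      using cs c by (intro mult_mono; simp)+
    ultimately show "0.21 < cos (\<eta> + t)" "0.21 < sin (\<eta> + t)"
      unfolding cos_add sin_add abs_le_iff by simp_all
  qed
  have low': "0.14 < l * x" if "0.68 \<le> l" "0.21 < x" for l x :: real
  proof -
    have "0.68 * 0.21 \<le> l * x"
      using that by (intro mult_mono) auto
    then show ?thesis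
      by simp
  qed
  show ?thesis
  proof (rule that [of r \<eta>])
    show "0 < r"
      by (rule rp)
    have "y - l0 * sin \<psi> + l1 * cos (b + \<psi>) = y + ((l1 * cos b) * cos \<psi> - (l0 + l1 * sin b) * sin \<psi>)" for y \<psi>
      by (simp add: cos_add algebra_simps)
    also have "\<dots> y \<psi> = y + r * sin (\<eta> - \<psi>)" for y \<psi>
      by (simp add: sin_diff algebra_simps flip: X Y)
    finally show "ht (K \<psi> y) C = y + r * sin (\<eta> - \<psi>)" for y \<psi>
      by simp
    show "\<bar>r * sin t\<bar> \<le> 1.1 * \<bar>t\<bar>" for t
      unfolding abs_mult using r rp abs_sin_le [of t] by (intro mult_mono) auto
  qed (use low low' l0 l1 l2 l3 in auto)
qed

text \<open>Near \<open>C\<close> the height of \<open>C\<close> is the controlled quantity, so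
  \<open>D\<close> is reached along \<open>CD\<close> instead of from \<open>A\<close>.\<close>

lemma ht_K_D': "ht (K \<psi> y) D = ht (K \<psi> y) C + l2 * sin (b + c + \<psi>)"
proof -
  have "cnj (fst (K \<psi> y)) * (D - C) = - ((cnj \<omega> * \<omega>) * (cis (- \<psi>) * cis (- b - c)) * l2)"
    unfolding CD by (simp add: cis_cnj)
  also have "\<dots> = - (cis (- (b + c + \<psi>)) * l2)"
    by (simp add: \<omega>_cnj cis_mult add.commute)
  finally have "Im (cnj (fst (K \<psi> y)) * (D - C)) = l2 * sin (b + c + \<psi>)"
    by (simp only: uminus_complex.sel Im_complex_of_real times_complex.sel cis.sel sin_minus Re_complex_of_real; simp)
  then show ?thesis
    using ht_diff [of "K \<psi> y" D C] by linarith
qed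

lemma bounce_AB':
  assumes "y < 0" "0 < y - l0 * sin \<psi>" "\<psi>' = - \<psi>" "y' = - y"
  shows "bounce S (K \<psi> y) (K \<psi>' y')"
  using bounce_AB assms by simp

lemma bounce_BC':
  assumes "ht (K \<psi> y) B < 0" "0 < ht (K \<psi> y) C" "\<psi>' = pi - 2 * b - \<psi>"
    and "ht (K \<psi>' y') C = - ht (K \<psi> y) C"
  shows "bounce S (K \<psi> y) (K \<psi>' y')"
  using bounce_BC [of \<psi> y y'] assms by blast

lemma bounce_CD':
  assumes "ht (K \<psi> y) C < 0" "0 < ht (K \<psi> y) D" "\<psi>' = - 2 * b - 2 * c - \<psi>"
    and "ht (K \<psi>' y') C = - ht (K \<psi> y) C"
  shows "bounce S (K \<psi> y) (K \<psi>' y')"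
  using bounce_CD [of \<psi> y y'] assms by blast

lemma bounce_DA':
  assumes "ht (K \<psi> y) D < 0" "0 < y" "\<psi>' = pi - 2 * a - \<psi>" "y' = - y"
  shows "bounce S (K \<psi> y) (K \<psi>' y')"
  using bounce_DA assms by blast

text \<open>The path runs to and fro near the diagonal \<open>AC\<close>, so that only the heights of \<open>A\<close> and \<open>C\<close> over
  the eight lines are small: they are \<open>\<plusminus> x\<close> at \<open>A\<close> and \<open>\<plusminus> z\<close> at \<open>C\<close>.\<close>

lemma opposite_acute:
  assumes "0 < a" "c < 0"
  shows "has_closed_path S 28"
proof -
  obtain r \<eta> where r: "0 < r" and C: "\<And>\<psi> y. ht (K \<psi> y) C = y + r * sin (\<eta> - \<psi>)"
    and near: "\<And>t. \<bar>r * sin t\<bar> \<le> 1.1 * \<bar>t\<bar>"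
    and far: "\<And>t. \<bar>t\<bar> \<le> 0.3 \<Longrightarrow> 0.14 < l0 * sin (\<eta> + t)"
      "\<And>t. \<bar>t\<bar> \<le> 0.3 \<Longrightarrow> 0.14 < l1 * cos (\<eta> + t)"
      "\<And>t. \<bar>t\<bar> \<le> 0.3 \<Longrightarrow> 0.14 < l2 * sin (\<eta> + t)"
      "\<And>t. \<bar>t\<bar> \<le> 0.3 \<Longrightarrow> 0.14 < l3 * cos (\<eta> + t)"
    using diagonal by blast
  \<comment> \<open>The solution of \<open>x - z = r * sin (a + c)\<close> and
    \<open>x + z = r * sin (a - c)\<close>, the height differences of \<open>A\<close> and
    \<open>C\<close>; acuteness at both ends makes \<open>x\<close> and \<open>z\<close>
    positive.\<close>
  define x where "x = r * sin a * cos c"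
  define z where "z = - (r * sin c * cos a)"
  have sc: "0 < sin a" "sin c < 0"
    using assms small pi_gt3 sin_gt_zero [of a] sin_gt_zero [of "- c"] by auto
  moreover have "0.9 \<le> cos a" "0.9 \<le> cos c"
    using small by (intro cos_ge_9_10; simp)+
  ultimately have xz: "0 < x" "0 < z"
    using r by (auto simp: x_def z_def mult_less_0_iff)
  have d1: "r * sin (a + c) = x - z" "r * sin (a - c) = x + z"
    by (simp_all add: x_def z_def sin_add sin_diff algebra_simps)
  have "\<bar>r * sin (a - c)\<bar> \<le> 0.13"
  proof -
    have "\<bar>a - c\<bar> \<le> 0.118"
      using small unfolding abs_le_iff by simp
    then show ?thesis
      using near [of "a - c"] by simp
  qed
  then have xz2: "x \<le> 0.13" "z \<le> 0.13"
    using d1 xz by auto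
  \<comment> \<open>The sides hit are \<open>AB, BC, CD, AB, DA, CD, BC, DA\<close>. The directions
    would close up for every \<open>\<psi>1\<close>; this choice makes the heights fit as
    well.\<close>
  define \<psi>1 where "\<psi>1 = \<eta> + a + c"
  define \<psi>2 where "\<psi>2 = pi - 2 * b - \<eta> - a - c"
  define \<psi>3 where "\<psi>3 = \<eta> + a - c - pi"
  define \<psi>4 where "\<psi>4 = pi - \<eta> - a + c"
  define \<psi>5 where "\<psi>5 = \<eta> - a - c"
  define \<psi>6 where "\<psi>6 = - \<eta> + a - 2 * b - c"
  define \<psi>7 where "\<psi>7 = pi + \<eta> - a + c"
  note \<psi> = \<psi>1_def \<psi>2_def \<psi>3_def \<psi>4_def \<psi>5_def \<psi>6_def \<psi>7_def
  define y2 where "y2 = - z - r * sin (\<eta> - \<psi>2)"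
  define y6 where "y6 = z - r * sin (\<eta> - \<psi>6)"
  have C1: "ht (K \<psi>1 x) C = z"
  proof -
    have "\<eta> - \<psi>1 = - (a + c)" by (simp add: \<psi>)
    then show ?thesis by (simp only: C sin_minus mult_minus_right d1; simp)
  qed
  have C3: "ht (K \<psi>3 (- x)) C = z"
  proof -
    have "\<eta> - \<psi>3 = pi - (a - c)" by (simp add: \<psi>)
    then show ?thesis by (simp only: C sin_pi_minus d1; simp)
  qed
  have C5: "ht (K \<psi>5 (- x)) C = - z"
  proof -
    have "\<eta> - \<psi>5 = a + c" by (simp add: \<psi>)
    then show ?thesis by (simp only: C d1; simp)
  qed
  have C7: "ht (K \<psi>7 x) C = - z"
  proof -
    have "\<eta> - \<psi>7 = (a - c) - pi" by (simp add: \<psi>)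
    then show ?thesis by (simp only: C sin_minus_pi mult_minus_right d1; simp)
  qed
  have C2: "ht (K \<psi>2 y2) C = - z" and C6: "ht (K \<psi>6 y6) C = z"
    by (simp_all add: C y2_def y6_def del: ht_K_C)
  have sm: "\<bar>a + c\<bar> \<le> 0.3" "\<bar>a - c\<bar> \<le> 0.3" "\<bar>c\<bar> \<le> 0.3" "\<bar>a + b\<bar> \<le> 0.3" "\<bar>b + c - a\<bar> \<le> 0.3"
    using small unfolding abs_le_iff by simp_all
  have "\<psi>1 = \<eta> + (a + c)"
    by (simp add: \<psi>)
  then have B1: "0.14 < l0 * sin \<psi>1"
    using far(1) [OF sm(1)] by simp
  have "\<psi>3 = (\<eta> + (a - c)) - pi"
    by (simp add: \<psi>)
  then have "sin \<psi>3 = - sin (\<eta> + (a - c))"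
    by (simp only: sin_minus_pi)
  then have B3: "0.14 < - (l0 * sin \<psi>3)"
    using far(1) [OF sm(2)] by simp
  have "a + \<psi>4 = pi - (\<eta> + - c)" "a + \<psi>5 = \<eta> + - c" "a + \<psi>7 = (\<eta> + c) + pi"
    by (simp_all add: \<psi>)
  then have "cos (a + \<psi>4) = - cos (\<eta> + - c)" "cos (a + \<psi>5) = cos (\<eta> + - c)" "cos (a + \<psi>7) = - cos (\<eta> + c)"
    by (simp_all only: cos_pi_minus cos_periodic_pi)
  then have D4: "l3 * cos (a + \<psi>4) < - 0.14" and D5: "0.14 < l3 * cos (a + \<psi>5)"
      and D7: "l3 * cos (a + \<psi>7) < - 0.14"
    using far(4) [OF sm(3)] far(4) [of "- c"] sm(3) by simp_all
  have "b + c + \<psi>2 = pi - (\<eta> + (a + b))"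
    by (simp add: \<psi>)
  then have "sin (b + c + \<psi>2) = sin (\<eta> + (a + b))"
    by (simp only: sin_pi_minus)
  then have D2: "0.14 < l2 * sin (b + c + \<psi>2)"
    using far(3) [OF sm(4)] by simp
  have "b + \<psi>6 = - (\<eta> + (b + c - a))"
    by (simp add: \<psi>)
  then have "cos (b + \<psi>6) = cos (\<eta> + (b + c - a))"
    by (simp only: cos_minus)
  then have B6: "0.14 < l1 * cos (b + \<psi>6)"
    using far(2) [OF sm(5)] by simp
  have C': "ht (K \<psi> y) B = ht (K \<psi> y) C - l1 * cos (b + \<psi>)" for \<psi> y
    by simp
  show ?thesis
  proof (rule closed_path_of_list [OF convex])
    let ?xs = "[K (- \<psi>1) (- x), K \<psi>1 x, K \<psi>2 y2, K \<psi>3 (- x), K \<psi>4 x, K \<psi>5 (- x), K \<psi>6 y6, K \<psi>7 x]"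
    have "bounce S (K (- \<psi>1) (- x)) (K \<psi>1 x)"
      using xz xz2 B1 by (intro bounce_AB') simp_all
    moreover have "bounce S (K \<psi>1 x) (K \<psi>2 y2)"
      by (rule bounce_BC', unfold C1 C2) (use xz xz2 B1 in \<open>simp_all add: \<psi>\<close>)
    moreover have "bounce S (K \<psi>2 y2) (K \<psi>3 (- x))"
      by (rule bounce_CD', unfold ht_K_D' C2 C3) (use xz xz2 D2 in \<open>simp_all add: \<psi>\<close>)
    moreover have "bounce S (K \<psi>3 (- x)) (K \<psi>4 x)"
      by (rule bounce_AB') (use xz xz2 B3 in \<open>simp_all add: \<psi>\<close>)
    moreover have "bounce S (K \<psi>4 x) (K \<psi>5 (- x))"
      by (rule bounce_DA') (use xz xz2 D4 in \<open>simp_all add: \<psi>\<close>)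
    moreover have "bounce S (K \<psi>5 (- x)) (K \<psi>6 y6)"
      by (rule bounce_CD', unfold C5 C6) (use xz xz2 D5 in \<open>simp_all add: \<psi>\<close>)
    moreover have "bounce S (K \<psi>6 y6) (K \<psi>7 x)"
      by (rule bounce_BC', unfold C' C6 C7) (use xz xz2 B6 in \<open>simp_all add: \<psi>\<close>)
    moreover have "bounce S (K \<psi>7 x) (K (- \<psi>1) (- x))"
      by (rule bounce_DA') (use xz xz2 D7 in \<open>simp_all add: \<psi>\<close>)
    ultimately show "successively (bounce S) ?xs" "bounce S (last ?xs) (hd ?xs)"
      by simp_all
  qed auto
qed

text \<open>For \<open>c = 0\<close> the height \<open>z\<close> of the previous path degenerates to
  0. At a right angle the two bounces near \<open>C\<close> reverse the direction in either order,
  so the second visit meets \<open>BC\<close> before \<open>CD\<close> as well.\<close>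

lemma right_C:
  assumes "0 < a" "c = 0"
  shows "has_closed_path S 28"
proof -
  obtain r \<eta> where r: "0 < r" and C: "\<And>\<psi> y. ht (K \<psi> y) C = y + r * sin (\<eta> - \<psi>)"
    and near: "\<And>t. \<bar>r * sin t\<bar> \<le> 1.1 * \<bar>t\<bar>"
    and far: "\<And>t. \<bar>t\<bar> \<le> 0.3 \<Longrightarrow> 0.14 < l0 * sin (\<eta> + t)"
      "\<And>t. \<bar>t\<bar> \<le> 0.3 \<Longrightarrow> 0.14 < l1 * cos (\<eta> + t)"
      "\<And>t. \<bar>t\<bar> \<le> 0.3 \<Longrightarrow> 0.14 < l2 * sin (\<eta> + t)"
      "\<And>t. \<bar>t\<bar> \<le> 0.3 \<Longrightarrow> 0.14 < l3 * cos (\<eta> + t)"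
    using diagonal by blast
  have "0 < sin a"
    using assms small pi_gt3 by (intro sin_gt_zero) auto
  \<comment> \<open>The height of \<open>C\<close> may lie anywhere between 0 and
    \<open>r * sin a\<close>; at the midpoint \<open>z\<close>, the heights of \<open>A\<close> are
    \<open>z\<close> and \<open>3 * z\<close> up to sign.\<close>
  then obtain z where z: "0 < z" "r * sin a = 2 * z"
    using r by (intro that [of "r * sin a / 2"]) auto
  have z2: "z \<le> 0.04"
    using near [of a] z small assms by simp
  define \<psi>1 where "\<psi>1 = \<eta> + a"
  define \<psi>2 where "\<psi>2 = pi - 2 * b - \<eta> - a"
  define \<psi>3 where "\<psi>3 = \<eta> + a - pi"
  define \<psi>4 where "\<psi>4 = pi - \<eta> - a"
  define \<psi>5 where "\<psi>5 = \<eta> - a"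
  define \<psi>6 where "\<psi>6 = pi - 2 * b - \<eta> + a"
  define \<psi>7 where "\<psi>7 = \<eta> - a - pi"
  note \<psi> = \<psi>1_def \<psi>2_def \<psi>3_def \<psi>4_def \<psi>5_def \<psi>6_def \<psi>7_def
  define y2 where "y2 = - z - r * sin (\<eta> - \<psi>2)"
  define y6 where "y6 = - z - r * sin (\<eta> - \<psi>6)"
  have C1: "ht (K \<psi>1 (3 * z)) C = z"
  proof -
    have "\<eta> - \<psi>1 = - a" by (simp add: \<psi>)
    then show ?thesis by (simp only: C sin_minus sin_pi_minus sin_periodic_pi mult_minus_right z; simp)
  qed
  have C3: "ht (K \<psi>3 (- z)) C = z"
  proof -
    have "\<eta> - \<psi>3 = pi - a" by (simp add: \<psi>)
    then show ?thesis by (simp only: C sin_minus sin_pi_minus sin_periodic_pi mult_minus_right z; simp)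
  qed
  have C5: "ht (K \<psi>5 (- z)) C = z"
    by (simp add: C z \<psi> del: ht_K_C)
  have C7: "ht (K \<psi>7 (3 * z)) C = z"
  proof -
    have "\<eta> - \<psi>7 = a + pi" by (simp add: \<psi>)
    then show ?thesis by (simp only: C sin_minus sin_pi_minus sin_periodic_pi mult_minus_right z; simp)
  qed
  have C2: "ht (K \<psi>2 y2) C = - z" and C6: "ht (K \<psi>6 y6) C = - z"
    by (simp_all add: C y2_def y6_def del: ht_K_C)
  have sm: "\<bar>a\<bar> \<le> 0.3" "\<bar>- a\<bar> \<le> 0.3" "\<bar>a + b\<bar> \<le> 0.3" "\<bar>b - a\<bar> \<le> 0.3"
    using small unfolding abs_le_iff by simp_all
  have B1: "0.14 < l0 * sin \<psi>1" and B5: "0.14 < l0 * sin \<psi>5"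
    using far(1) [OF sm(1)] far(1) [OF sm(2)] by (simp_all add: \<psi>)
  have "sin \<psi>3 = - sin \<psi>1"
    unfolding sin_minus_pi [symmetric] by (simp add: \<psi>)
  then have B3: "0.14 < - (l0 * sin \<psi>3)"
    using B1 by simp
  have "cos (a + \<psi>4) = - cos \<eta>" "cos (a + \<psi>7) = - cos \<eta>"
    unfolding cos_pi_minus [symmetric] cos_minus_pi [symmetric] by (simp_all add: \<psi>)
  then have D4: "l3 * cos (a + \<psi>4) < - 0.14" and D7: "l3 * cos (a + \<psi>7) < - 0.14"
    using far(4) [of 0] by simp_all
  have "b + c + \<psi>2 = pi - (\<eta> + (a + b))" "b + c + \<psi>6 = pi - (\<eta> + (b - a))"
    by (simp_all add: \<psi> assms)
  then have "sin (b + c + \<psi>2) = sin (\<eta> + (a + b))" "sin (b + c + \<psi>6) = sin (\<eta> + (b - a))"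
    by (simp_all only: sin_pi_minus)
  then have D2: "0.14 < l2 * sin (b + c + \<psi>2)" and D6: "0.14 < l2 * sin (b + c + \<psi>6)"
    using far(3) [OF sm(3)] far(3) [OF sm(4)] by simp_all
  show ?thesis
  proof (rule closed_path_of_list [OF convex])
    let ?xs = "[K (- \<psi>1) (- (3 * z)), K \<psi>1 (3 * z), K \<psi>2 y2, K \<psi>3 (- z), K \<psi>4 z, K \<psi>5 (- z),
      K \<psi>6 y6, K \<psi>7 (3 * z)]"
    have "bounce S (K (- \<psi>1) (- (3 * z))) (K \<psi>1 (3 * z))"
      using z z2 B1 by (intro bounce_AB') simp_all
    moreover have "bounce S (K \<psi>1 (3 * z)) (K \<psi>2 y2)"
      by (rule bounce_BC', unfold C1 C2) (use z z2 B1 in \<open>simp_all add: \<psi>\<close>)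
    moreover have "bounce S (K \<psi>2 y2) (K \<psi>3 (- z))"
      by (rule bounce_CD', unfold ht_K_D' C2 C3) (use z z2 D2 in \<open>simp_all add: \<psi> assms\<close>)
    moreover have "bounce S (K \<psi>3 (- z)) (K \<psi>4 z)"
      by (rule bounce_AB') (use z z2 B3 in \<open>simp_all add: \<psi>\<close>)
    moreover have "bounce S (K \<psi>4 z) (K \<psi>5 (- z))"
      by (rule bounce_DA') (use z z2 D4 in \<open>simp_all add: \<psi>\<close>)
    moreover have "bounce S (K \<psi>5 (- z)) (K \<psi>6 y6)"
      by (rule bounce_BC', unfold C5 C6) (use z z2 B5 in \<open>simp_all add: \<psi>\<close>)
    moreover have "bounce S (K \<psi>6 y6) (K \<psi>7 (3 * z))"
      by (rule bounce_CD', unfold ht_K_D' C6 C7) (use z z2 D6 in \<open>simp_all add: \<psi> assms\<close>)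
    \<comment> \<open>The direction comes back after a full turn, which \<open>K_periodic\<close>
      removes below.\<close>
    moreover have "bounce S (K \<psi>7 (3 * z)) (K (- \<psi>1 + 2 * pi) (- (3 * z)))"
      by (rule bounce_DA') (use z z2 D7 in \<open>simp_all add: \<psi>\<close>)
    ultimately show "successively (bounce S) ?xs" "bounce S (last ?xs) (hd ?xs)"
      by (simp_all only: K_periodic) simp_all
  qed auto
qed

end

section \<open>Covering all near-square quadrilaterals\<close>

lemma sides_shift: "sides B C D A = sides A B C D"
  by (auto simp: sides_def)

text \<open>Conjugation swaps the ends of each side; the squared direction in the reflection law
  absorbs the resulting sign.\<close>

lemma has_closed_path_mirror:
  assumes "has_closed_path (sides (cnj A) (cnj D) (cnj C) (cnj B)) N"
  shows "has_closed_path (sides A B C D) N"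
proof -
  let ?E = "sides A B C D" and ?E' = "sides (cnj A) (cnj D) (cnj C) (cnj B)"
  have E': "(cnj Q, cnj P) \<in> ?E" if "(P, Q) \<in> ?E'" for P Q
    using that by (auto simp: sides_def)
  have "cross (cnj Q) (cnj P) z = cross P Q (cnj z)" for P Q z
    by (simp add: cross_def algebra_simps)
  then have inner': "z \<in> inside_sides ?E'  \<Longrightarrow> cnj z \<in> inside_sides ?E" for z
    unfolding inside_sides_def sides_def by auto
  have seg: "open_segment (cnj P) (cnj Q) = cnj ` open_segment P Q" for P Q
    by (intro open_segment_linear_image bounded_linear.linear bounded_linear_cnj) (simp add: inj_def)
  have sgn_cnj: "sgn (cnj z) = cnj (sgn z)" for z
    by (simp add: sgn_eq)
  obtain p m where m: "0 < m" "m \<le> N" "\<And>i. p (i + m) = p i"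
    and p: "\<And>i. p i \<noteq> p (Suc i)" "\<And>i. open_segment (p i) (p (Suc i)) \<subseteq> inside_sides ?E'"
    and refl: "\<And>i. \<exists>(P, Q) \<in> ?E'. p (Suc i) \<in> open_segment P Q \<and>
       sgn (p (Suc (Suc i)) - p (Suc i)) = (sgn (Q - P))\<^sup>2 * cnj (sgn (p (Suc i) - p i))"
    using assms unfolding has_closed_path_def by blast
  show ?thesis
    unfolding has_closed_path_def
  proof (intro exI [of _ "cnj \<circ> p"] exI [of _ m] conjI allI)
    fix i
    show "(cnj \<circ> p) i \<noteq> (cnj \<circ> p) (Suc i)"
      using p(1) by simp
    show "open_segment ((cnj \<circ> p) i) ((cnj \<circ> p) (Suc i)) \<subseteq> inside_sides ?E"
      using p(2) [of i] inner' by (auto simp: seg)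
    obtain P Q where PQ: "(P, Q) \<in> ?E'" "p (Suc i) \<in> open_segment P Q"
       "sgn (p (Suc (Suc i)) - p (Suc i)) = (sgn (Q - P))\<^sup>2 * cnj (sgn (p (Suc i) - p i))"
      using refl [of i] by auto
    have "sgn (cnj P - cnj Q) = - cnj (sgn (Q - P))"
      by (metis complex_cnj_diff minus_diff_eq sgn_cnj sgn_minus)
    moreover have "cnj (p (Suc i)) \<in> open_segment (cnj Q) (cnj P)"
      using PQ(2) by (simp add: seg open_segment_commute)
    moreover have "sgn (cnj (p (Suc (Suc i))) - cnj (p (Suc i))) =
        (cnj (sgn (Q - P)))\<^sup>2 * cnj (sgn (cnj (p (Suc i)) - cnj (p i)))"
      using arg_cong [OF PQ(3), of cnj] by (simp flip: sgn_cnj)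
    ultimately show "\<exists>(P, Q) \<in> ?E. (cnj \<circ> p) (Suc i) \<in> open_segment P Q \<and>
       sgn ((cnj \<circ> p) (Suc (Suc i)) - (cnj \<circ> p) (Suc i)) =
         (sgn (Q - P))\<^sup>2 * cnj (sgn ((cnj \<circ> p) (Suc i) - (cnj \<circ> p) i))"
      using E' [OF PQ(1)] by (intro bexI [of _ "(cnj Q, cnj P)"]) auto
  qed (use m in auto)
qed

context near_square_quad
begin

text \<open>If \<open>c\<close> is positive, \<open>a = b + c + d\<close> and
  \<open>b \<le> d\<close> give \<open>2 * b < a\<close>, so the cases are exhaustive.\<close>

lemma one_acute:
  assumes "0 < a" "0 \<le> b" "0 \<le> c" "b \<le> d"
  shows "has_closed_path S 28"
proof -
  consider "c = 0" | "b = 0" | "0 < b" "2 * b < a" "a < 3 * b" | "0 < b" "a = 3 * b" | "0 < b" "3 * b < a"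
    using assms sum by linarith
  then show ?thesis
    using assms by cases (auto intro: right_C right_B obtuse_B_less obtuse_B_three obtuse_B_more)
qed

text \<open>If \<open>D\<close> is acute too, relabelling from \<open>D\<close> gives the adjacent
  case; if \<open>A\<close> is the only acute angle and \<open>d \<le> b\<close>, the mirror image
  applies.\<close>

lemma acute_A:
  assumes "0 < a"
  shows "has_closed_path S 28"
proof -
  interpret B: near_square_quad B C D A "\<omega> * \<i> * cis (- b)" l1 l2 l3 l0 "- b" c d "- a"
    by (rule shift)
  interpret C: near_square_quad C D A B "\<omega> * \<i> * cis (- b) * \<i> * cis (- c)" l2 l3 l0 l1 "- c" d "- a" b
    using B.shift by simp
  interpret D: near_square_quad D A B C "\<omega> * \<i> * cis (- b) * \<i> * cis (- c) * \<i> * cis (- d)" l3 l0 l1 l2 "- d" "- a" b c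
    using C.shift by simp
  interpret M: near_square_quad "cnj A" "cnj D" "cnj C" "cnj B" "- \<i> * cnj \<omega> * cis a" l3 l2 l1 l0 a d c b
    by (rule mirror)
  consider "b < 0" | "c < 0" | "d < 0" | "0 \<le> b" "0 \<le> c" "b \<le> d" | "0 \<le> d" "0 \<le> c" "d \<le> b"
    by linarith
  then show ?thesis
  proof cases
    case 3
    then show ?thesis
      using D.adjacent_acute assms by (simp add: sides_shift [of A B C D])
  next
    case 5
    then show ?thesis
      using M.one_acute assms has_closed_path_mirror by blast
  qed (use assms adjacent_acute opposite_acute one_acute in auto)
qed

text \<open>Without an acute angle, \<open>a \<le> 0\<close> and \<open>b\<close>, \<open>c\<close>,
  \<open>d\<close> are nonnegative, so \<open>a = b + c + d\<close> forces a rectangle.\<close>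

lemma closed_path: "has_closed_path S 28"
proof -
  interpret B: near_square_quad B C D A "\<omega> * \<i> * cis (- b)" l1 l2 l3 l0 "- b" c d "- a"
    by (rule shift)
  interpret C: near_square_quad C D A B "\<omega> * \<i> * cis (- b) * \<i> * cis (- c)" l2 l3 l0 l1 "- c" d "- a" b
    using B.shift by simp
  interpret D: near_square_quad D A B C "\<omega> * \<i> * cis (- b) * \<i> * cis (- c) * \<i> * cis (- d)" l3 l0 l1 l2 "- d" "- a" b c
    using C.shift by simp
  have S: "sides B C D A = S" "sides C D A B = S" "sides D A B C = S"
    by (auto simp: sides_def)
  consider "0 < a" | "b < 0" | "c < 0" | "d < 0" | "a = 0" "b = 0" "c = 0"
    using sum by linarith
  then show ?thesis
    using acute_A B.acute_A C.acute_A D.acute_A rectangle unfolding S by cases auto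
qed

end

text \<open>The counterclockwise order makes vertex 3 the locale's \<open>B\<close> and vertex 1 its
  \<open>D\<close>. The side lengths come from the law of sines with diagonal 1.\<close>

lemma near_square_quad_vertices:
  assumes a: "a \<in> quad_space" and near: "near_square (pi / 107) a"
  shows "near_square_quad (vertex a 0) (vertex a 3) (vertex a 2) (vertex a 1) (cis (- a$4))
    (sin (a$3) / sin (a$3 + a$4)) (sin (a$4) / sin (a$3 + a$4))
    (sin (a$1) / sin (a$1 + a$2)) (sin (a$2) / sin (a$1 + a$2))
    (pi/2 - a$1 - a$4) (pi/2 - a$3 - a$4) (a$2 + a$3 - pi/2) (pi/2 - a$1 - a$2)"
proof -
  \<comment> \<open>\<open>pi / 107\<close> is about 0.02936; twice the rounded bound is the 0.059
    of the locale.\<close>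
  have n: "\<bar>a$i - pi/4\<bar> \<le> 0.0295" for i
    using near pi_approx unfolding near_square_def by (auto dest!: spec [of _ i])
  have "1.4142 \<le> sqrt 2"
    by (rule real_le_rsqrt) (simp add: power2_eq_square)
  moreover have "sqrt 2 \<le> 1.4144"
    by (rule real_le_lsqrt) (simp_all add: power2_eq_square)
  ultimately have "0.7071 \<le> sqrt 2 / 2" "sqrt 2 / 2 \<le> 0.7072"
    by simp_all
  have s: "0.685 \<le> sin (a$i)" "sin (a$i) \<le> 0.7285" for i
  proof -
    define t where "t = a$i - pi/4"
    have t: "\<bar>t\<bar> \<le> 0.0295"
      using n t_def by simp
    have "t\<^sup>2 \<le> 0.0295\<^sup>2"
      using t by (subst abs_le_square_iff [symmetric]) simp
    then have c: "0.999 \<le> cos t"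
      using cos_ge_quadratic [of t] by (simp add: power2_eq_square)
    have "\<bar>sin t\<bar> \<le> 0.0295"
      using abs_sin_le [of t] t by simp
    then have "0.969 \<le> cos t + sin t" "cos t + sin t \<le> 1 + 0.0295"
      using c unfolding abs_le_iff by (simp, intro add_mono) simp_all
    moreover have "sin (a$i) = sqrt 2 / 2 * (cos t + sin t)"
      using sin_add [of "pi/4" t] by (simp add: t_def sin_45 cos_45 distrib_left)
    moreover have "0.7071 * 0.969 \<le> sqrt 2 / 2 * (cos t + sin t)" "sqrt 2 / 2 * (cos t + sin t) \<le> 0.7072 * (1 + 0.0295)"
      using calculation \<open>0.7071 \<le> sqrt 2 / 2\<close> \<open>sqrt 2 / 2 \<le> 0.7072\<close> by (intro mult_mono; simp)+
    ultimately show "0.685 \<le> sin (a$i)" "sin (a$i) \<le> 0.7285"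
      by auto
  qed
  have d: "0.998 \<le> sin (a$i + a$j)" for i j
  proof -
    define t where "t = a$i + a$j - pi/2"
    have "\<bar>t\<bar> \<le> 0.059"
      using n [of i] n [of j] unfolding t_def abs_le_iff by simp
    then have "t\<^sup>2 \<le> 0.059\<^sup>2"
      by (subst abs_le_square_iff [symmetric]) simp
    then have "0.998 \<le> cos t"
      using cos_ge_quadratic [of t] by (simp add: power2_eq_square)
    moreover have "sin (a$i + a$j) = cos t"
      using sin_add [of "pi/2" t] by (simp add: t_def)
    ultimately show ?thesis
      by simp
  qed
  \<comment> \<open>These are the side length bounds of the locale; the upper one is nearly sharp,
    as \<open>0.73 * 0.998 = 0.72854\<close>.\<close>
  have quotient: "0.68 \<le> x / y" "x / y \<le> 0.73" if "0.685 \<le> x" "x \<le> 0.7285" "0.998 \<le> y" "y \<le> 1"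
    for x y :: real
    using that by (simp_all add: pos_le_divide_eq pos_divide_le_eq)
  note l = quotient [OF s d sin_le_one]
  have "sin (a$i + a$j) \<noteq> 0" for i j
    by (rule less_imp_neq [symmetric], rule less_le_trans [OF _ d]) simp
  then have nz: "sin (a$1 + a$2) \<noteq> 0" "sin (a$3 + a$4) \<noteq> 0"
    by blast+
  \<comment> \<open>The two sides of a triangle add up to its base, here the diagonal.\<close>
  have tri: "sin x * cis (- y) + sin y * cis x = sin (x + y)" for x y :: real
    by (simp add: complex_eq_iff sin_add algebra_simps)
  have i: "\<i> * cis x = cis (pi/2 + x)" for x
    by (simp add: complex_eq_iff cos_add sin_add)
  show ?thesis
  proof
    have "complex_of_real (sin (a$4) / sin (a$3 + a$4)) * cis (a$3) =
        1 - complex_of_real (sin (a$3) / sin (a$3 + a$4)) * cis (- a$4)"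
      using tri [of "a$3" "a$4"] nz by (simp add: field_simps)
    moreover have "cis (- a$4) * \<i> * cis (- (pi/2 - a$3 - a$4)) = cis (a$3)"
      by (simp add: mult.assoc i cis_mult)
    ultimately show "vertex a 2 - vertex a 3 = cis (- a$4) * \<i> * cis (- (pi/2 - a$3 - a$4))
        * complex_of_real (sin (a$4) / sin (a$3 + a$4))"
      by (simp add: mult.commute)
    have "complex_of_real (sin (a$1) / sin (a$1 + a$2)) * cis (- a$2) =
        1 - complex_of_real (sin (a$2) / sin (a$1 + a$2)) * cis (a$1)"
      using tri [of "a$1" "a$2"] nz by (simp add: field_simps)
    moreover have "cis (- a$4) * cis (- (pi/2 - a$3 - a$4) - (a$2 + a$3 - pi/2)) = cis (- a$2)"
      by (simp add: cis_mult)
    ultimately show "vertex a 1 - vertex a 2 = - (cis (- a$4) *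
        cis (- (pi/2 - a$3 - a$4) - (a$2 + a$3 - pi/2)) * complex_of_real (sin (a$1) / sin (a$1 + a$2)))"
      by (simp add: mult.commute)
    have "cis (- a$4) * \<i> * cis (- (pi/2 - a$1 - a$4)) = cis (a$1)"
      by (simp add: mult.assoc i cis_mult)
    then show "vertex a 0 - vertex a 1 = - (cis (- a$4) * \<i> * cis (- (pi/2 - a$1 - a$4))
        * complex_of_real (sin (a$2) / sin (a$1 + a$2)))"
      by (simp add: mult.commute)
    show "\<bar>pi/2 - a$1 - a$4\<bar> \<le> 0.059" "\<bar>pi/2 - a$3 - a$4\<bar> \<le> 0.059" "\<bar>a$2 + a$3 - pi/2\<bar> \<le> 0.059"
      "\<bar>pi/2 - a$1 - a$2\<bar> \<le> 0.059"
      using n [of 1] n [of 2] n [of 3] n [of 4] unfolding abs_le_iff by simp_all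
    show "cmod (cis (- a$4)) = 1"
      by simp
    show "vertex a 3 - vertex a 0 = cis (- a$4) * complex_of_real (sin (a$3) / sin (a$3 + a$4))"
      by (simp add: mult.commute)
    show "pi/2 - a$1 - a$4 = pi/2 - a$3 - a$4 + (a$2 + a$3 - pi/2) + (pi/2 - a$1 - a$2)"
      by simp
  qed (rule l)+
qed

theorem theorem2p2p4:
  shows "(\<exists>S. finite S \<and>
            {a \<in> quad_space. near_square (pi/107) a} \<subseteq> (\<Union>W\<in>S. orbit_tile W))
       \<and> (\<forall>a \<in> quad_space. near_square (pi/107) a \<longrightarrow>
            (\<exists>p s. periodic_billiard_path a p s))"
proof -
  have closed: "has_closed_path (quad_sides a) 28" if "a \<in> quad_space" "near_square (pi/107) a" for a
    using near_square_quad.closed_path [OF near_square_quad_vertices [OF that]] .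
  show ?thesis
  proof (intro conjI ballI impI)
    show "\<exists>S. finite S \<and> {a \<in> quad_space. near_square (pi/107) a} \<subseteq> (\<Union>W\<in>S. orbit_tile W)"
      by (rule finite_cover_of_closed_paths) (rule closed)
    show "\<exists>p s. periodic_billiard_path a p s" if "a \<in> quad_space" "near_square (pi/107) a" for a
      using billiard_of_closed_path [OF that(1) closed [OF that]] by blast
  qed
qed

end
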